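(* Let $n\ge 1$ and let $I\subset\mathbb{R}$ be an open interval. Given smooth functions $\kappa_1(s),\dots,\kappa_n(s)$ on $I$, there exists a horizontal curve $\gamma:I\to H_n$, parametrized by horizontal arc-length $s$, having $\kappa_1,\dots,\kappa_n$ as its p-curvatures. In addition, two horizontal curves (parametrized by horizontal arc-length) having the same p-curvatures differ by a rigid motion: if $\gamma_1,\gamma_2$ are two such curves, there is $\Phi\in PSH(n)$ with $\gamma_2=\Phi\circ\gamma_1$.
   Context: Heisenberg group. $H_n$ is $\mathbb{R}^{2n+1}$ with coordinates $(x_1,\dots,x_n,y_1,\dots,y_n,z)$ and group law $(x,y,z)\circ(\tilde x,\tilde y,\tilde z)=(x+\tilde x,\,y+\tilde y,\,z+\tilde z+\sum_{j=1}^n(y_j\tilde x_j-x_j\tilde y_j))$. Left invariant vector fields: $\mathring e_j=\partial_{x_j}+y_j\partial_z$, $\mathring e_{n+j}=\partial_{y_j}-x_j\partial_z$ $(1\le j\le n)$, $T=\partial_z$. The contact bundle $\xi$ is spanned by $\mathring e_1,\dots,\mathring e_{2n}$; it is the kernel of $\theta=dz+\sum_{j=1}^n(x_j\,dy_j-y_j\,dx_j)$. The almost complex structure $J$ on $\xi$ is $J\mathring e_j=\mathring e_{n+j}$, $J\mathring e_{n+j}=-\mathring e_j$. The Levi metric is the inner product on $\xi$ for which $\mathring e_1,\dots,\mathring e_{2n}$ are orthonormal; $\langle\cdot,\cdot\rangle$ denotes its extension to the tangent bundle making $T$ a unit vector orthogonal to $\xi$. $PSH(n)$ (the group of rigid motions,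 or symmetries) is the group of diffeomorphisms $\Phi:H_n\to H_n$ with $\Phi_*(\xi)=\xi$, $\Phi_*J=J\Phi_*$ on $\xi$, and $\Phi^*\theta=\theta$. Curves. All curves are smooth. For a curve $\gamma$ in $H_n$, $\gamma^{(k)}$ is the $k$-th coordinate derivative in $\mathbb{R}^{2n+1}$, decomposed as $\gamma^{(k)}=\gamma^{(k)}_\xi+\gamma^{(k)}_T$ with $\gamma^{(k)}_\xi\in\xi$ and $\gamma^{(k)}_T$ a multiple of $T$ at the point of the curve; thus $\gamma^{(k)}_\xi=\sum_j (x_j^{(k)}\mathring e_j+y_j^{(k)}\mathring e_{n+j})$. The curve is horizontal if $\gamma'=\gamma'_\xi$ everywhere, horizontally regular if $\gamma'_\xi\neq0$ everywhere, and parametrized by horizontal arc-length $s$ if $|\gamma'_\xi(s)|=1$ for all $s$. A non-degenerate horizontally regular curve is a horizontally regular curve such that for all $t$: (i) $\gamma'_\xi(t)\wedge\cdots\wedge\gamma^{(n)}_\xi(t)\neq0$ (real wedge product), and (ii) the real span of $\{\gamma'_\xi(t),\dots,\gamma^{(n)}_\xi(t)\}$ is totally real, where a real subspace $P\subset\xi$ is totally real if $JX\notin P$ for every nonzero $X\in P$. Oriented frames and p-curvatures. An oriented frame at $p\in H_n$ is $(p;e_1,\dots,e_{2n},T)$ with $e_1,\dots,e_{2n}$ an orthonormal basis of $\xi_p$ and $e_{n+j}=Je_j$ for $1\le j\le n$ (the space of oriented frames is identified with $PSH(n)$). The p-curvatures are defined for non-degenerate horizontally regular curves $\gamma(s)$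 parametrized by horizontal arc-length, as follows: one chooses a smooth oriented frame $(\gamma(s);e_1(s),\dots,e_{2n}(s),T)$ along $\gamma$ such that for $1\le j\le n$ $$e_1(s)\wedge\cdots\wedge e_j(s)=\pm\frac{\gamma'_\xi(s)\wedge\cdots\wedge\gamma_\xi^{(j)}(s)}{|\gamma'_\xi(s)\wedge\cdots\wedge\gamma_\xi^{(j)}(s)|},\qquad e_{n+j}(s)=Je_j(s).$$ With respect to such a frame, the p-curvatures are $\kappa_j(s)=\langle \frac{de_j}{ds},e_{j+1}\rangle$ for $1\le j\le n-1$ and $\kappa_n(s)=\langle\frac{de_n}{ds},e_{2n}\rangle$. Here $\frac{de_j}{ds}$ is the derivative of $e_j(s)$ as an $\mathbb{R}^{2n+1}$-valued function; its component in $\xi$ is obtained by differentiating the coefficients of $e_j$ with respect to $\mathring e_1,\dots,\mathring e_{2n}$. A curve "having p-curvatures" is understood to be one for which they are so defined.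
   Formalization: Existence additionally assumes that κ_1,…,κ_{n-1} vanish nowhere on I (no condition on κ_n); this is necessary, since p-curvatures are defined only for non-degenerate curves and κ_j(s)=0 with j<n would make the wedge of the derivatives vanish. *)

theory Defs
  imports "HOL-Analysis.Analysis"
begin

text \<open>
  \<open>n = CARD('n)\<close>. A point of \<open>H\<^sub>n\<close> is \<open>(x, y, z)\<close>, and a tangent vector at a point is
  the vector \<open>(a, b, c)\<close> of its components with respect to
  \<open>\<partial>\<^sub>x\<close>, \<open>\<partial>\<^sub>y\<close>, \<open>\<partial>\<^sub>z\<close>, so both have the same type.
\<close>

type_synonym 'n heis = "(real^'n) \<times> (real^'n) \<times> real"

definition X_field :: "'n::finite \<Rightarrow> 'n heis \<Rightarrow> 'n heis" where
  "X_field j = (\<lambda>(x, y, z). (axis j 1, 0, y $ j))"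

definition Y_field :: "'n::finite \<Rightarrow> 'n heis \<Rightarrow> 'n heis" where
  "Y_field j = (\<lambda>(x, y, z). (0, axis j 1, - (x $ j)))"

definition T_field :: "'n::finite heis" where
  "T_field = (0, 0, 1)"

definition contact :: "'n::finite heis \<Rightarrow> 'n heis set" where
  "contact p = span (range (\<lambda>j. X_field j p) \<union> range (\<lambda>j. Y_field j p))"

definition theta :: "'n::finite heis \<Rightarrow> 'n heis \<Rightarrow> real" where
  "theta = (\<lambda>(x, y, z) (a, b, c). c + (\<Sum>j\<in>UNIV. x $ j * b $ j - y $ j * a $ j))"

text \<open>
  The component in the contact bundle along the splitting by \<^const>\<open>T_field\<close>. The coefficients
  of \<open>(a, b, c)\<close> with respect to \<open>X_field j p\<close>, \<open>Y_field j p\<close>, \<open>T_field\<close> are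
  \<open>a $ j\<close>, \<open>b $ j\<close> and \<open>theta p (a, b, c)\<close>.
\<close>

definition contact_part :: "'n::finite heis \<Rightarrow> 'n heis \<Rightarrow> 'n heis" where
  "contact_part p = (\<lambda>(a, b, c). \<Sum>j\<in>UNIV. (a $ j) *\<^sub>R X_field j p + (b $ j) *\<^sub>R Y_field j p)"

text \<open>Only the values of \<open>J p\<close> on \<open>contact p\<close> are meaningful.\<close>

definition J :: "'n::finite heis \<Rightarrow> 'n heis \<Rightarrow> 'n heis" where
  "J p = (\<lambda>(a, b, c). \<Sum>j\<in>UNIV. (a $ j) *\<^sub>R Y_field j p - (b $ j) *\<^sub>R X_field j p)"

definition levi :: "'n::finite heis \<Rightarrow> 'n heis \<Rightarrow> 'n heis \<Rightarrow> real" where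
  "levi p u v =
     (case u of (a, b, c) \<Rightarrow> case v of (a', b', c') \<Rightarrow>
       (\<Sum>j\<in>UNIV. a $ j * a' $ j + b $ j * b' $ j) + theta p u * theta p v)"

definition levi_norm :: "'n::finite heis \<Rightarrow> 'n heis \<Rightarrow> real" where
  "levi_norm p v = sqrt (levi p v v)"

lemma vector_decomposition: "v = contact_part p v + theta p v *\<^sub>R T_field"
proof -
  obtain x y z where p: "p = (x, y, z)" by (cases p) auto
  obtain a b c where v: "v = (a, b, c)" by (cases v) auto
  have "fst (contact_part p v) = a" "fst (snd (contact_part p v)) = b"
    by (simp_all add: contact_part_def X_field_def Y_field_def p v fst_sum snd_sum vec_eq_iff
        axis_def if_distrib cong: if_cong)
  moreover have "snd (snd (contact_part p v)) = - (\<Sum>j\<in>UNIV. x $ j * b $ j - y $ j * a $ j)"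
    by (simp add: contact_part_def X_field_def Y_field_def p v snd_sum algebra_simps
        flip: sum_negf)
  ultimately show ?thesis
    by (simp add: p v theta_def T_field_def prod_eq_iff)
qed

lemma J_fields: "J p (X_field j p) = Y_field j p" "J p (Y_field j p) = - X_field j p"
proof -
  obtain x y z where p: "p = (x, y, z)" by (cases p) auto
  have *: "(axis j (1::real)) $ i *\<^sub>R u = (if i = j then u else 0)" for i and u :: "'a heis"
    by (simp add: axis_def)
  show "J p (X_field j p) = Y_field j p"
    using * by (simp add: J_def X_field_def p flip: zero_prod_def)
  show "J p (Y_field j p) = - X_field j p"
    using * by (simp add: J_def Y_field_def p sum_negf flip: zero_prod_def)
qed

lemma theta_fields:
  "theta p (X_field j p) = 0" "theta p (Y_field j p) = 0" "theta p T_field = 1"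
proof -
  obtain x y z where p: "p = (x, y, z)" by (cases p) auto
  have *: "r * (axis j (1::real)) $ i = (if i = j then r else 0)" for i r
    by (simp add: axis_def)
  show "theta p (X_field j p) = 0" "theta p (Y_field j p) = 0" "theta p T_field = 1"
    by (simp_all add: theta_def X_field_def Y_field_def T_field_def p * sum_negf)
qed

lemma levi_fields:
  "levi p (X_field i p) (X_field j p) = (if i = j then 1 else 0)"
  "levi p (Y_field i p) (Y_field j p) = (if i = j then 1 else 0)"
  "levi p (X_field i p) (Y_field j p) = 0"
  "levi p (X_field i p) T_field = 0"
  "levi p (Y_field i p) T_field = 0"
  "levi p T_field T_field = 1"
proof -
  obtain x y z where p: "p = (x, y, z)" by (cases p) auto
  have *: "(axis i (1::real)) $ k * (axis j 1) $ k = (if k = i then if i = j then 1 else 0 else 0)"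
    for k by (simp add: axis_def)
  show "levi p (X_field i p) (X_field j p) = (if i = j then 1 else 0)"
    "levi p (Y_field i p) (Y_field j p) = (if i = j then 1 else 0)"
    "levi p (X_field i p) (Y_field j p) = 0"
    "levi p (X_field i p) T_field = 0"
    "levi p (Y_field i p) T_field = 0"
    "levi p T_field T_field = 1"
    unfolding levi_def theta_fields
    by (simp_all add: X_field_def Y_field_def T_field_def p * theta_def)
qed

text \<open>
  \<open>C\<^sup>k\<close> on an open set. In finite dimension, continuity of all directional derivatives
  \<open>\<lambda>x. f' x v\<close> is continuity of the derivative.
\<close>

primrec C_on :: "nat \<Rightarrow> 'a::euclidean_space set \<Rightarrow> ('a \<Rightarrow> 'b::euclidean_space) \<Rightarrow> bool" where
  "C_on 0 S f \<longleftrightarrow> continuous_on S f"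
| "C_on (Suc k) S f \<longleftrightarrow>
     (\<exists>f'. (\<forall>x\<in>S. (f has_derivative f' x) (at x)) \<and> (\<forall>v. C_on k S (\<lambda>x. f' x v)))"

definition smooth_on :: "'a::euclidean_space set \<Rightarrow> ('a \<Rightarrow> 'b::euclidean_space) \<Rightarrow> bool" where
  "smooth_on S f \<longleftrightarrow> (\<forall>k. C_on k S f)"

definition PSH :: "('n::finite heis \<Rightarrow> 'n heis) set" where
  "PSH = {\<Phi>. bij \<Phi> \<and> smooth_on UNIV \<Phi> \<and> smooth_on UNIV (inv \<Phi>) \<and>
     (\<forall>p. frechet_derivative \<Phi> (at p) ` contact p = contact (\<Phi> p)) \<and>
     (\<forall>p. \<forall>v\<in>contact p.
        frechet_derivative \<Phi> (at p) (J p v) = J (\<Phi> p) (frechet_derivative \<Phi> (at p) v)) \<and>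
     (\<forall>p v. theta (\<Phi> p) (frechet_derivative \<Phi> (at p) v) = theta p v)}"

text \<open>
  Curves are total functions of which only the restriction to the open interval \<open>I\<close> matters.
\<close>

definition curve_deriv :: "nat \<Rightarrow> (real \<Rightarrow> 'n::finite heis) \<Rightarrow> real \<Rightarrow> 'n heis" where
  "curve_deriv k \<gamma> = ((\<lambda>g t. vector_derivative g (at t)) ^^ k) \<gamma>"

definition contact_deriv :: "nat \<Rightarrow> (real \<Rightarrow> 'n::finite heis) \<Rightarrow> real \<Rightarrow> 'n heis" where
  "contact_deriv k \<gamma> t = contact_part (\<gamma> t) (curve_deriv k \<gamma> t)"

definition horizontal_on :: "real set \<Rightarrow> (real \<Rightarrow> 'n::finite heis) \<Rightarrow> bool" where
  "horizontal_on I \<gamma> \<longleftrightarrow>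
     smooth_on I \<gamma> \<and> (\<forall>t\<in>I. curve_deriv 1 \<gamma> t = contact_deriv 1 \<gamma> t)"

definition horizontally_regular_on :: "real set \<Rightarrow> (real \<Rightarrow> 'n::finite heis) \<Rightarrow> bool" where
  "horizontally_regular_on I \<gamma> \<longleftrightarrow> smooth_on I \<gamma> \<and> (\<forall>t\<in>I. contact_deriv 1 \<gamma> t \<noteq> 0)"

definition horizontal_arc_length_on :: "real set \<Rightarrow> (real \<Rightarrow> 'n::finite heis) \<Rightarrow> bool" where
  "horizontal_arc_length_on I \<gamma> \<longleftrightarrow>
     smooth_on I \<gamma> \<and> (\<forall>s\<in>I. levi_norm (\<gamma> s) (contact_deriv 1 \<gamma> s) = 1)"

text \<open>
  The \<open>j\<close>-vector \<open>v\<^sub>1 \<and> \<dots> \<and> v\<^sub>j\<close> at \<open>p\<close>, identified by means of the metric with the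
  alternating form \<open>(w\<^sub>1, \<dots>, w\<^sub>j) \<mapsto> det \<langle>v\<^sub>i, w\<^sub>k\<rangle>\<close>. The inner product on \<open>j\<close>-vectors is
  \<open>\<langle>v\<^sub>1 \<and> \<dots> \<and> v\<^sub>j, w\<^sub>1 \<and> \<dots> \<and> w\<^sub>j\<rangle> = det \<langle>v\<^sub>i, w\<^sub>k\<rangle>\<close>, so the norm is the root of the Gram
  determinant.
\<close>

definition wedge ::
  "'n::finite heis \<Rightarrow> nat \<Rightarrow> (nat \<Rightarrow> 'n heis) \<Rightarrow> ((nat \<Rightarrow> 'n heis) \<Rightarrow> real)" where
  "wedge p j v =
     (\<lambda>w. \<Sum>\<sigma> | \<sigma> permutes {1..j}. of_int (sign \<sigma>) * (\<Prod>i=1..j. levi p (v i) (w (\<sigma> i))))"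

definition wedge_norm :: "'n::finite heis \<Rightarrow> nat \<Rightarrow> (nat \<Rightarrow> 'n heis) \<Rightarrow> real" where
  "wedge_norm p j v = sqrt (wedge p j v v)"

definition totally_real :: "'n::finite heis \<Rightarrow> 'n heis set \<Rightarrow> bool" where
  "totally_real p P \<longleftrightarrow> subspace P \<and> P \<subseteq> contact p \<and> (\<forall>X\<in>P. X \<noteq> 0 \<longrightarrow> J p X \<notin> P)"

definition nondegenerate_on :: "real set \<Rightarrow> (real \<Rightarrow> 'n::finite heis) \<Rightarrow> bool" where
  "nondegenerate_on I \<gamma> \<longleftrightarrow> horizontally_regular_on I \<gamma> \<and>
     (\<forall>t\<in>I. wedge (\<gamma> t) CARD('n) (\<lambda>k. contact_deriv k \<gamma> t) \<noteq> (\<lambda>_. 0) \<and>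
            totally_real (\<gamma> t) (span ((\<lambda>k. contact_deriv k \<gamma> t) ` {1..CARD('n)})))"

text \<open>The last leg \<open>T\<close> of a frame is fixed and left implicit.\<close>

definition oriented_frame :: "'n::finite heis \<Rightarrow> (nat \<Rightarrow> 'n heis) \<Rightarrow> bool" where
  "oriented_frame p e \<longleftrightarrow>
     (\<forall>i\<in>{1..2 * CARD('n)}. \<forall>j\<in>{1..2 * CARD('n)}. levi p (e i) (e j) = (if i = j then 1 else 0)) \<and>
     span (e ` {1..2 * CARD('n)}) = contact p \<and>
     (\<forall>j\<in>{1..CARD('n)}. e (CARD('n) + j) = J p (e j))"

text \<open>\<open>e j s\<close> is the \<open>j\<close>-th leg at parameter \<open>s\<close>.\<close>

definition adapted_frame ::
  "real set \<Rightarrow> (real \<Rightarrow> 'n::finite heis) \<Rightarrow> (nat \<Rightarrow> real \<Rightarrow> 'n heis) \<Rightarrow> bool" where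
  "adapted_frame I \<gamma> e \<longleftrightarrow>
     (\<forall>j\<in>{1..2 * CARD('n)}. smooth_on I (e j)) \<and>
     (\<forall>s\<in>I. oriented_frame (\<gamma> s) (\<lambda>j. e j s)) \<and>
     (\<forall>s\<in>I. \<forall>j\<in>{1..CARD('n)}. \<exists>\<epsilon>\<in>{1, -1}.
        wedge (\<gamma> s) j (\<lambda>i. e i s) =
          (\<lambda>w. \<epsilon> * (wedge (\<gamma> s) j (\<lambda>k. contact_deriv k \<gamma> s) w /
                     wedge_norm (\<gamma> s) j (\<lambda>k. contact_deriv k \<gamma> s))))"

text \<open>
  The signs in \<^const>\<open>adapted_frame\<close> leave \<open>\<kappa>\<^sub>j\<close> with \<open>j < n\<close> determined only up to
  sign by the curve, hence a relation between \<open>\<gamma>\<close> and \<open>\<kappa>\<close>. Non-degeneracy forces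
  \<open>\<kappa>\<^sub>1, \<dots>, \<kappa>\<^bsub>n-1\<^esub>\<close> to be nowhere zero; \<open>\<kappa>\<^sub>n\<close> is unrestricted.
\<close>

definition has_p_curvatures ::
  "real set \<Rightarrow> (real \<Rightarrow> 'n::finite heis) \<Rightarrow> (nat \<Rightarrow> real \<Rightarrow> real) \<Rightarrow> bool" where
  "has_p_curvatures I \<gamma> \<kappa> \<longleftrightarrow>
     nondegenerate_on I \<gamma> \<and> horizontal_arc_length_on I \<gamma> \<and>
     (\<exists>e. adapted_frame I \<gamma> e \<and>
       (\<forall>s\<in>I.
         (\<forall>j\<in>{1..<CARD('n)}.
            \<kappa> j s = levi (\<gamma> s) (vector_derivative (e j) (at s)) (e (j + 1) s)) \<and>
         \<kappa> CARD('n) s =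
           levi (\<gamma> s) (vector_derivative (e CARD('n)) (at s)) (e (2 * CARD('n)) s)))"

end

theory Submission
  imports Defs
begin

text \<open>
  In the complex coordinates \<open>a + \<i> b\<close> of a tangent vector \<open>(a, b, c)\<close> the Levi metric on the
  contact planes is the real part of the standard Hermitian product of \<open>\<complex>\<^sup>n\<close>, \<open>J\<close> is multiplication
  by \<open>\<i>\<close>, and \<open>\<theta>\<close> at \<open>p\<close> is \<open>height v - Im \<langle>p, v\<rangle>\<close>. An oriented frame is therefore a unitary
  frame \<open>e\<^sub>1, \<dots>, e\<^sub>n\<close> of \<open>\<complex>\<^sup>n\<close>, and a horizontal curve is determined by its projection to \<open>\<complex>\<^sup>n\<close>
  together with one initial height.

  The condition that a frame is adapted to a curve says that the coordinate derivatives
  \<open>c\<^sub>1, \<dots>, c\<^sub>n\<close> of the projection have a real lower triangular matrix with nonzero diagonal with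
  respect to the frame (\<open>wedge_triangular_legs\<close>, \<open>triangular_of_wedge\<close>). Differentiating the
  coefficients \<open>\<langle>c\<^sub>k, e\<^sub>i\<rangle>\<close> shows that triangularity is equivalent to the Frenet equations
  \<open>e\<^sub>j' = \<Sum>\<^sub>k A\<^bsub>jk\<^esub> e\<^sub>k\<close> with the anti-Hermitian tridiagonal matrix \<open>A\<close> formed from the
  p-curvatures (\<open>frenet_of_triangular\<close>), where in the direction from the equations to the
  triangular shape \<open>c\<^sub>1 = e\<^sub>1\<close> and nonzero \<open>\<kappa>\<^sub>1, \<dots>, \<kappa>\<^bsub>n-1\<^esub>\<close> are given
  (\<open>triangular_of_frenet\<close>).

  This is a linear system, solvable on the whole interval (\<open>linear_ODE_solution\<close>). For two
  solutions, written as matrices \<open>M\<close> and \<open>N\<close> with the legs as rows, \<open>M\<^sup>* N\<close> is constant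
  (\<open>moving_frames_product_constant\<close>). Existence: starting from a unitary frame, the solution stays
  unitary, and integrating \<open>e\<^sub>1\<close> and then the height yields the curve. Uniqueness: the frames of two
  curves with the same p-curvatures differ by a constant unitary map, which up to sign carries one
  projected velocity to the other; a unitary map followed by a left translation is a rigid motion
  (\<open>rigid_motion_in_PSH\<close>), and after integration one such motion takes one curve to the other.
\<close>

section \<open>Calculus of differentiability classes\<close>

lemma C_on_cong:
  assumes "open S" "\<And>x. x \<in> S \<Longrightarrow> f x = g x" "C_on k S f"
  shows "C_on k S g"
proof (cases k)
  case 0
  then show ?thesis using assms by (simp cong: continuous_on_cong)
next
  case (Suc l)
  then obtain f' where f': "\<And>x. x \<in> S \<Longrightarrow> (f has_derivative f' x) (at x)"
    "\<And>v. C_on l S (\<lambda>x. f' x v)"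
    using assms(3) by auto
  have "(g has_derivative f' x) (at x)" if "x \<in> S" for x
    using has_derivative_transform_within_open[OF f'(1)[OF that] assms(1) that assms(2)] by simp
  then show ?thesis using f'(2) Suc by auto
qed

lemma C_on_Suc_imp: "C_on (Suc k) S f \<Longrightarrow> C_on k S f"
proof (induction k arbitrary: f)
  case 0
  then obtain f' where "\<forall>x\<in>S. (f has_derivative f' x) (at x)" by auto
  then show ?case unfolding C_on.simps
    by (meson continuous_at_imp_continuous_on has_derivative_continuous)
next
  case (Suc k)
  from Suc.prems obtain f' where f': "\<forall>x\<in>S. (f has_derivative f' x) (at x)"
    "\<forall>v. C_on (Suc k) S (\<lambda>x. f' x v)"
    unfolding C_on.simps(2)[of "Suc k"] by blast
  then show ?case using Suc.IH by auto
qed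

lemma C_on_linear: "bounded_linear h \<Longrightarrow> C_on k S f \<Longrightarrow> C_on k S (\<lambda>x. h (f x))"
proof (induction k arbitrary: f)
  case 0
  then show ?case by (simp add: bounded_linear.continuous_on)
next
  case (Suc k)
  from Suc.prems obtain f' where f': "\<forall>x\<in>S. (f has_derivative f' x) (at x)"
    "\<forall>v. C_on k S (\<lambda>x. f' x v)" by auto
  have "\<forall>x\<in>S. ((\<lambda>x. h (f x)) has_derivative (\<lambda>v. h (f' x v))) (at x)"
    using f'(1) Suc.prems(1) bounded_linear.has_derivative by blast
  then show ?case
    using Suc.IH[OF Suc.prems(1)] f'(2) by (auto intro!: exI[of _ "\<lambda>x v. h (f' x v)"])
qed

lemma C_on_const: "C_on k S (\<lambda>_. c)"
  by (induction k arbitrary: c) (auto intro!: exI[of _ "\<lambda>_ _. 0"])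

lemma C_on_add: "C_on k S f \<Longrightarrow> C_on k S g \<Longrightarrow> C_on k S (\<lambda>x. f x + g x)"
proof (induction k arbitrary: f g)
  case 0
  then show ?case by (simp add: continuous_on_add)
next
  case (Suc k)
  from Suc.prems obtain f' g' where "\<forall>x\<in>S. (f has_derivative f' x) (at x)"
    "\<forall>v. C_on k S (\<lambda>x. f' x v)" "\<forall>x\<in>S. (g has_derivative g' x) (at x)"
    "\<forall>v. C_on k S (\<lambda>x. g' x v)" by auto
  then show ?case
    using Suc.IH by (auto intro!: exI[of _ "\<lambda>x v. f' x v + g' x v"] has_derivative_add)
qed

lemma C_on_sum: "(\<And>i. i \<in> F \<Longrightarrow> C_on k S (f i)) \<Longrightarrow> C_on k S (\<lambda>x. \<Sum>i\<in>F. f i x)"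
  by (induction F rule: infinite_finite_induct) (auto intro: C_on_const C_on_add)

text \<open>
  The product rule involves \<open>f\<close> and \<open>g\<close> themselves next to their derivatives, so the induction
  needs that a \<open>C\<^bsup>k+1\<^esup>\<close> function is \<open>C\<^sup>k\<close>.
\<close>

lemma C_on_bilinear:
  assumes "bounded_bilinear h"
  shows "C_on k S f \<Longrightarrow> C_on k S g \<Longrightarrow> C_on k S (\<lambda>x. h (f x) (g x))"
proof (induction k arbitrary: f g)
  case 0
  then show ?case using assms by (simp add: bounded_bilinear.continuous_on)
next
  case (Suc k)
  from Suc.prems obtain f' g' where d: "\<forall>x\<in>S. (f has_derivative f' x) (at x)"
    "\<forall>v. C_on k S (\<lambda>x. f' x v)" "\<forall>x\<in>S. (g has_derivative g' x) (at x)"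
    "\<forall>v. C_on k S (\<lambda>x. g' x v)" by auto
  have "C_on k S f" "C_on k S g" using Suc.prems by (auto dest: C_on_Suc_imp simp del: C_on.simps)
  then have "C_on k S (\<lambda>x. h (f x) (g' x v) + h (f' x v) (g x))" for v
    using Suc.IH d by (intro C_on_add) auto
  moreover have "\<forall>x\<in>S. ((\<lambda>x. h (f x) (g x)) has_derivative
      (\<lambda>v. h (f x) (g' x v) + h (f' x v) (g x))) (at x)"
    using d bounded_bilinear.FDERIV[OF assms] by blast
  ultimately show ?case
    by (auto intro!: exI[of _ "\<lambda>x v. h (f x) (g' x v) + h (f' x v) (g x)"])
qed

lemma C_on_Suc_vector_derivative:
  assumes "\<And>x. x \<in> S \<Longrightarrow> (f has_vector_derivative f' x) (at x)" "C_on k S f'"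
  shows "C_on (Suc k) S f"
proof -
  have "C_on k S (\<lambda>x. v *\<^sub>R f' x)" for v
    using C_on_linear[OF bounded_linear_scaleR_right assms(2)] .
  then show ?thesis
    using assms(1) by (auto simp: has_vector_derivative_def intro!: exI[of _ "\<lambda>x v. v *\<^sub>R f' x"])
qed

text \<open>
  Different orders \<open>k\<close> may come with different witnesses for the derivative; uniqueness of the
  derivative merges them into one.
\<close>

lemma smooth_on_vector_derivative:
  fixes f :: "real \<Rightarrow> 'a::euclidean_space"
  assumes "open S" "smooth_on S f"
  shows "x \<in> S \<Longrightarrow> (f has_vector_derivative vector_derivative f (at x)) (at x)"
    and "smooth_on S (\<lambda>x. vector_derivative f (at x))"
proof -
  have *: "(\<forall>x\<in>S. (f has_vector_derivative vector_derivative f (at x)) (at x)) \<and>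
    C_on k S (\<lambda>x. vector_derivative f (at x))" for k
  proof -
    obtain f' where f': "\<forall>x\<in>S. (f has_derivative f' x) (at x)" "\<forall>v. C_on k S (\<lambda>x. f' x v)"
      using assms(2) unfolding smooth_on_def by (metis C_on.simps(2))
    have d: "(f has_vector_derivative f' x 1) (at x)" if "x \<in> S" for x
    proof -
      have "f' x = (\<lambda>v. v *\<^sub>R f' x 1)"
        using f'(1) that by (metis has_derivative_linear linear_cmul mult.right_neutral real_scaleR_def)
      then show ?thesis using f'(1) that by (metis has_vector_derivative_def)
    qed
    then have e: "f' x 1 = vector_derivative f (at x)" if "x \<in> S" for x
      using vector_derivative_at[OF d[OF that]] by simp
    then show ?thesis using d C_on_cong[OF assms(1) e] f'(2) by auto
  qed
  then show "x \<in> S \<Longrightarrow> (f has_vector_derivative vector_derivative f (at x)) (at x)"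
    and "smooth_on S (\<lambda>x. vector_derivative f (at x))"
    by (auto simp: smooth_on_def)
qed

lemma smooth_on_continuous: "smooth_on S f \<Longrightarrow> continuous_on S f"
  unfolding smooth_on_def by (metis C_on.simps(1))

lemma smooth_on_linear: "bounded_linear h \<Longrightarrow> smooth_on S f \<Longrightarrow> smooth_on S (\<lambda>x. h (f x))"
  by (simp add: smooth_on_def C_on_linear)

lemma smooth_on_const: "smooth_on S (\<lambda>_. c)"
  by (simp add: smooth_on_def C_on_const)

lemma smooth_on_add: "smooth_on S f \<Longrightarrow> smooth_on S g \<Longrightarrow> smooth_on S (\<lambda>x. f x + g x)"
  by (simp add: smooth_on_def C_on_add)

lemma smooth_on_bilinear:
  "bounded_bilinear h \<Longrightarrow> smooth_on S f \<Longrightarrow> smooth_on S g \<Longrightarrow> smooth_on S (\<lambda>x. h (f x) (g x))"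
  by (simp add: smooth_on_def C_on_bilinear)

text \<open>For curves, smoothness is inherited from the velocity; this is how solutions of the
  differential equations below are seen to be smooth.\<close>

lemma smooth_on_of_derivative:
  assumes "\<And>x. x \<in> S \<Longrightarrow> (f has_vector_derivative f' x) (at x)" "smooth_on S f'"
  shows "smooth_on S f"
  unfolding smooth_on_def
proof
  fix k
  have "C_on (Suc k) S f"
    using C_on_Suc_vector_derivative[OF assms(1)] assms(2) by (auto simp: smooth_on_def)
  then show "C_on k S f" by (rule C_on_Suc_imp)
qed

section \<open>Linear differential equations on an open interval\<close>

lemma compact_subinterval:
  fixes I :: "real set"
  assumes "open I" "is_interval I" "s \<in> I" "t \<in> I"
  obtains a b where "a < s" "s < b" "a < t" "t < b" "{a..b} \<subseteq> I"
proof -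
  have "\<exists>e>0. \<forall>y. \<bar>y - u\<bar> \<le> e \<longrightarrow> y \<in> I" if "u \<in> I" for u
    using open_contains_cball_eq[OF assms(1)] that
    by (metis dist_commute dist_real_def mem_cball subsetD)
  then obtain d e where d: "d > 0" "\<forall>y. \<bar>y - s\<bar> \<le> d \<longrightarrow> y \<in> I"
    and e: "e > 0" "\<forall>y. \<bar>y - t\<bar> \<le> e \<longrightarrow> y \<in> I"
    using assms(3,4) by metis
  let ?a = "min (s - d) (t - e)" and ?b = "max (s + d) (t + e)"
  have "?a \<in> I" "?b \<in> I" using d e by (auto simp: min_def max_def)
  then have "{?a..?b} \<subseteq> I" using mem_is_interval_1_I[OF assms(2)] by (meson atLeastAtMost_iff subsetI)
  then show thesis using that[of ?a ?b] d(1) e(1) by auto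
qed

lemma antiderivative_on_open_interval:
  fixes f :: "real \<Rightarrow> 'a::euclidean_space"
  assumes "open I" "is_interval I" "s\<^sub>0 \<in> I" "continuous_on I f"
  shows "\<exists>F. (\<forall>s\<in>I. (F has_vector_derivative f s) (at s)) \<and> F s\<^sub>0 = c"
proof -
  let ?F = "\<lambda>u. (LBINT y=s\<^sub>0..u. f y)"
  have F: "(?F has_vector_derivative f s) (at s)" if s: "s \<in> I" for s
  proof -
    obtain a b where ab: "a < s" "s < b" "a < s\<^sub>0" "s\<^sub>0 < b" "{a..b} \<subseteq> I"
      using compact_subinterval[OF assms(1,2) s assms(3)] .
    have "(?F has_vector_derivative f s) (at s within {a..b})"
      using ab assms(4) by (intro interval_integral_FTC2) (auto intro: continuous_on_subset)
    then have "(?F has_vector_derivative f s) (at s within {a<..<b})"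
      by (rule has_vector_derivative_within_subset) auto
    moreover have "at s within {a<..<b} = at s" using ab(1,2) by (intro at_within_open) auto
    ultimately show ?thesis by (simp only:)
  qed
  have "((\<lambda>u. ?F u + (c - ?F s\<^sub>0)) has_vector_derivative f s + 0) (at s)" if "s \<in> I" for s
    by (rule has_vector_derivative_add[OF F[OF that] has_vector_derivative_const])
  then have "\<forall>s\<in>I. ((\<lambda>u. ?F u + (c - ?F s\<^sub>0)) has_vector_derivative f s) (at s)"
    by (simp only: add_0_right) blast
  moreover have "?F s\<^sub>0 + (c - ?F s\<^sub>0) = c" by (simp only: add_diff_eq add_diff_cancel_left')
  ultimately show ?thesis by (intro exI conjI)
qed

text \<open>The factorial gained at each integration makes the series of iterates converge.\<close>

lemma picard_iterate_bound:
  fixes L :: "real \<Rightarrow> 'a::real_normed_vector \<Rightarrow>\<^sub>L 'a"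
  assumes K: "convex K" "s\<^sub>0 \<in> K" "\<And>t. t \<in> K \<Longrightarrow> norm (L t) \<le> C"
    and P0: "\<And>t. P 0 t = y\<^sub>0"
    and PS: "\<And>m t. t \<in> K \<Longrightarrow> (P (Suc m) has_vector_derivative L t (P m t)) (at t)"
      "\<And>m. P (Suc m) s\<^sub>0 = 0"
    and s: "s \<in> K"
  shows "norm (P m s) \<le> norm y\<^sub>0 * (C * \<bar>s - s\<^sub>0\<bar>) ^ m / fact m"
  using s
proof (induction m arbitrary: s)
  case 0
  then show ?case by (simp add: P0)
next
  case (Suc m)
  define r where "r = s - s\<^sub>0"
  define q where "q = norm y\<^sub>0 * (C * \<bar>r\<bar>) ^ Suc m / fact m"
  have C: "C \<ge> 0" using K(2,3) norm_ge_zero order_trans by blast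
  have in_K: "s\<^sub>0 + t * r \<in> K" if "0 \<le> t" "t \<le> 1" for t
  proof -
    have "(1 - t) *\<^sub>R s\<^sub>0 + t *\<^sub>R s \<in> K" using K(1,2) Suc.prems that convexD_alt by fastforce
    then show ?thesis by (simp add: r_def algebra_simps)
  qed
  \<comment> \<open>Running along the segment from \<open>s\<^sub>0\<close> to \<open>s\<close> treats both sides of \<open>s\<^sub>0\<close> at once.\<close>
  let ?f = "\<lambda>t. P (Suc m) (s\<^sub>0 + t * r)" and ?f' = "\<lambda>t. r *\<^sub>R L (s\<^sub>0 + t * r) (P m (s\<^sub>0 + t * r))"
  let ?g = "\<lambda>t. q / real (Suc m) * t ^ Suc m" and ?g' = "\<lambda>t. q * t ^ m"
  have df: "(?f has_vector_derivative ?f' t) (at t)" if "0 \<le> t" "t \<le> 1" for t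
  proof -
    have "((\<lambda>t. s\<^sub>0 + t * r) has_real_derivative r) (at t)"
      by (auto intro!: derivative_eq_intros)
    then have "((\<lambda>t. s\<^sub>0 + t * r) has_vector_derivative r) (at t)"
      by (simp add: has_real_derivative_iff_has_vector_derivative)
    from vector_diff_chain_at[OF this, of "P (Suc m)", OF PS(1)[OF in_K[OF that]]]
    show ?thesis by (simp add: o_def)
  qed
  have dg: "(?g has_vector_derivative ?g' t) (at t)" for t
    unfolding has_real_derivative_iff_has_vector_derivative[symmetric]
    by (rule derivative_eq_intros refl | simp add: field_simps del: of_nat_Suc)+
  have "norm (?f 1 - ?f 0) \<le> ?g 1 - ?g 0"
  proof (rule differentiable_bound_general[of 0 1 ?f ?g ?f' ?g'])
    show "continuous_on {0..1} ?f" "continuous_on {0..1} ?g"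
      using df dg by (auto intro!: continuous_at_imp_continuous_on has_vector_derivative_continuous)
    show "norm (?f' t) \<le> ?g' t" if t: "0 < t" "t < 1" for t
    proof -
      have k: "s\<^sub>0 + t * r \<in> K" using in_K t by simp
      have "norm (?f' t) \<le> \<bar>r\<bar> * (norm (L (s\<^sub>0 + t * r)) * norm (P m (s\<^sub>0 + t * r)))"
        by (simp add: mult_left_mono norm_blinfun)
      also have "\<dots> \<le> \<bar>r\<bar> * (C * (norm y\<^sub>0 * (C * (t * \<bar>r\<bar>)) ^ m / fact m))"
        using Suc.IH[OF k] K(3)[OF k] C t
        by (intro mult_left_mono mult_mono) (auto simp: abs_mult)
      also have "\<dots> = ?g' t" by (simp add: q_def power_mult_distrib)
      finally show ?thesis .
    qed
  qed (use df dg in auto)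
  then show ?case by (simp add: PS(2) q_def r_def field_simps del: of_nat_Suc)
qed

text \<open>The solution is the sum of Picard's iterated integrals.\<close>

theorem linear_ODE_solution:
  fixes L :: "real \<Rightarrow> 'a::euclidean_space \<Rightarrow>\<^sub>L 'a"
  assumes I: "open I" "is_interval I" "s\<^sub>0 \<in> I" and L: "continuous_on I L"
  obtains y where "\<And>s. s \<in> I \<Longrightarrow> (y has_vector_derivative L s (y s)) (at s)" "y s\<^sub>0 = y\<^sub>0"
proof -
  define primitive where "primitive f = (SOME F. (\<forall>s\<in>I. (F has_vector_derivative f s) (at s)) \<and> F s\<^sub>0 = 0)"
    for f :: "real \<Rightarrow> 'a"
  have prim: "(\<forall>s\<in>I. (primitive f has_vector_derivative f s) (at s)) \<and> primitive f s\<^sub>0 = 0"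
    if "continuous_on I f" for f
    unfolding primitive_def
    using someI_ex[OF antiderivative_on_open_interval[OF I that, of 0]] .
  define P where "P = rec_nat (\<lambda>_. y\<^sub>0) (\<lambda>_ p. primitive (\<lambda>t. L t (p t)))"
  have P0: "P 0 = (\<lambda>_. y\<^sub>0)" and PS: "P (Suc m) = primitive (\<lambda>t. L t (P m t))" for m
    by (simp_all add: P_def)
  have contL: "continuous_on I (\<lambda>t. L t (p t))" if "continuous_on I p" for p
    using L that by (intro continuous_intros)
  have contP: "continuous_on I (P m)" for m
  proof (induction m)
    case (Suc m)
    show ?case unfolding PS
      by (intro continuous_at_imp_continuous_on ballI has_vector_derivative_continuous)
        (use prim[OF contL[OF Suc]] in blast)
  qed (simp add: P0)
  have dP: "(P (Suc m) has_vector_derivative L s (P m s)) (at s)" if "s \<in> I" for m s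
    using prim[OF contL[OF contP[of m]]] that by (simp add: PS)
  have P_s0: "P (Suc m) s\<^sub>0 = 0" for m
    using prim[OF contL[OF contP[of m]]] by (simp add: PS)
  define D where "D i s = (case i of 0 \<Rightarrow> 0 | Suc m \<Rightarrow> L s (P m s))" for i s
  have dPD: "(P i has_vector_derivative D i s) (at s)" if "s \<in> I" for i s
    using dP[OF that] by (cases i) (auto simp: D_def P0)
  define y where "y s = (\<Sum>m. P m s)" for s
  have "(y has_vector_derivative L s (y s)) (at s)" if s: "s \<in> I" for s
  proof -
    obtain a b where ab: "a < s" "s < b" "a < s\<^sub>0" "s\<^sub>0 < b" "{a..b} \<subseteq> I"
      using compact_subinterval[OF I(1,2) s I(3)] .
    have mem: "s \<in> {a..b}" "s\<^sub>0 \<in> {a..b}" "s \<in> {a<..<b}" using ab(1-4) by auto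
    have in_I: "t \<in> I" if "t \<in> {a..b}" for t using ab(5) that by (rule subsetD)
    have "compact (L ` {a..b})" 
      by (rule compact_continuous_image[OF continuous_on_subset[OF L ab(5)] compact_Icc])
    then obtain C where C: "\<And>t. t \<in> {a..b} \<Longrightarrow> norm (L t) \<le> C"
      by (meson bounded_iff compact_imp_bounded imageI)
    have C0: "C \<ge> 0" by (rule order_trans[OF norm_ge_zero C[OF mem(1)]])
    define B where "B = (\<lambda>m. norm y\<^sub>0 * (C * (b - a)) ^ m / fact m)"
    have bd: "norm (P m t) \<le> B m" if t: "t \<in> {a..b}" for m t
    proof -
      have "norm (P m t) \<le> norm y\<^sub>0 * (C * \<bar>t - s\<^sub>0\<bar>) ^ m / fact m"
        by (rule picard_iterate_bound[of "{a..b}" s\<^sub>0 L C P])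
          (simp_all only: C P_s0 dP[OF in_I] mem t convex_real_interval P0)
      also have "\<dots> \<le> B m" unfolding B_def
        using t ab(3,4) C0 by (intro divide_right_mono mult_left_mono power_mono) auto
      finally show ?thesis .
    qed
    have sumB: "summable B"
      using summable_mult[OF summable_exp[of "C * (b - a)"], of "norm y\<^sub>0"]
      by (simp add: B_def divide_inverse mult_ac)
    have sumP: "summable (\<lambda>m. P m t)" if "t \<in> {a..b}" for t
      by (rule summable_comparison_test'[OF sumB, of 0]) (rule bd[OF that])
    define E where "E i = (case i of 0 \<Rightarrow> 0 | Suc m \<Rightarrow> C * B m)" for i
    have sumE: "summable E"
      using summable_mult[OF sumB, of C] by (subst summable_Suc_iff[symmetric]) (simp add: E_def)
    have bdD: "norm (D i t) \<le> E i" if "t \<in> {a..b}" for i t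
    proof (cases i)
      case (Suc m)
      have "norm (L t (P m t)) \<le> norm (L t) * norm (P m t)" by (rule norm_blinfun)
      also have "\<dots> \<le> C * B m" using C[OF that] bd[OF that] C0 by (intro mult_mono) auto
      finally show ?thesis by (simp add: D_def E_def Suc)
    qed (simp add: D_def E_def)
    have unif: "uniform_limit {a..b} (\<lambda>n t. \<Sum>i<n. D i t) (\<lambda>t. \<Sum>i. D i t) sequentially"
      using Weierstrass_m_test[OF bdD sumE] .
    have sumD: "(\<Sum>i. D i t) = L t (y t)" if "t \<in> {a..b}" for t
    proof -
      have "(\<lambda>i. D (Suc i) t) sums L t (y t)"
        using bounded_linear.sums[OF blinfun.bounded_linear_right[of "L t"] summable_sums[OF sumP[OF that]]]
        by (simp add: D_def y_def)
      then have "(\<lambda>i. D i t) sums L t (y t)"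
        by (subst (asm) sums_Suc_iff) (simp add: D_def)
      then show ?thesis by (simp add: sums_iff)
    qed
    have "\<exists>g. \<forall>t\<in>{a<..<b}. (\<lambda>n. P n t) sums g t \<and>
        (g has_derivative (\<lambda>h. h *\<^sub>R L t (y t))) (at t within {a<..<b})"
    proof (rule has_derivative_series[where f' = "\<lambda>i t h. h *\<^sub>R D i t"])
      show "(P n has_derivative (\<lambda>h. h *\<^sub>R D n t)) (at t within {a<..<b})"
        if "t \<in> {a<..<b}" for n t
      proof -
        have "t \<in> I" using that by (intro in_I) auto
        then show ?thesis
          using dPD has_derivative_at_withinI unfolding has_vector_derivative_def by blast
      qed
      show "\<forall>\<^sub>F n in sequentially. \<forall>t\<in>{a<..<b}. \<forall>h.
          norm ((\<Sum>i<n. h *\<^sub>R D i t) - h *\<^sub>R L t (y t)) \<le> e * norm h" if "e > 0" for e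
        using uniform_limitD[OF unif that]
      proof eventually_elim
        case (elim n)
        show ?case
        proof (intro ballI allI)
          fix t h assume "t \<in> {a<..<b}"
          then have t: "t \<in> {a..b}" by simp
          have "norm ((\<Sum>i<n. D i t) - L t (y t)) \<le> e"
            using bspec[OF elim t] sumD[OF t] by (simp add: dist_norm)
          then have "\<bar>h\<bar> * norm ((\<Sum>i<n. D i t) - L t (y t)) \<le> \<bar>h\<bar> * e"
            by (intro mult_left_mono) auto
          moreover have "(\<Sum>i<n. h *\<^sub>R D i t) - h *\<^sub>R L t (y t) = h *\<^sub>R ((\<Sum>i<n. D i t) - L t (y t))"
            by (simp add: scaleR_right.sum scaleR_right_diff_distrib)
          ultimately show "norm ((\<Sum>i<n. h *\<^sub>R D i t) - h *\<^sub>R L t (y t)) \<le> e * norm h"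
            by (simp add: mult.commute)
        qed
      qed
      show "s \<in> {a<..<b}" "(\<lambda>n. P n s) sums (\<Sum>n. P n s)"
        using mem(3) summable_sums[OF sumP[OF mem(1)]] by auto
    qed auto
    then obtain g where g: "\<And>t. t \<in> {a<..<b} \<Longrightarrow> y t = g t"
      "\<And>t. t \<in> {a<..<b} \<Longrightarrow> (g has_derivative (\<lambda>h. h *\<^sub>R L t (y t))) (at t within {a<..<b})"
      unfolding y_def by (metis sums_iff)
    have "(g has_derivative (\<lambda>h. h *\<^sub>R L s (y s))) (at s)"
      using g(2)[OF mem(3)] at_within_open[OF mem(3)] by simp
    then show ?thesis unfolding has_vector_derivative_def
      by (rule has_derivative_transform_within_open[of _ _ _ _ "{a<..<b}"]) (use mem(3) g(1) in auto)
  qed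
  moreover have "P m s\<^sub>0 = (if m = 0 then y\<^sub>0 else 0)" for m
    by (cases m) (simp_all add: P_s0 P0)
  then have "(\<lambda>m. P m s\<^sub>0) sums y\<^sub>0"
    using sums_single[of 0 "\<lambda>_. y\<^sub>0"] by simp
  then have "y s\<^sub>0 = y\<^sub>0" by (simp add: y_def sums_iff)
  ultimately show thesis using that by blast
qed

text \<open>Legs and derivatives are numbered from \<open>1\<close>, which should not turn into \<open>Suc 0\<close> in index ranges.\<close>

declare One_nat_def [simp del]

section \<open>Unitary frames of complex vectors\<close>

text \<open>
  The Hermitian product. On the contact planes its real part is the Levi metric and its imaginary
  part the symplectic form that governs the height of a horizontal curve.
\<close>

definition hprod :: "complex^'n::finite \<Rightarrow> complex^'n \<Rightarrow> complex" where
  "hprod u v = (\<Sum>a\<in>UNIV. u $ a * cnj (v $ a))"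

lemma hprod_linear:
  "hprod (u + u') v = hprod u v + hprod u' v" "hprod u (v + v') = hprod u v + hprod u v'"
  "hprod (u - u') v = hprod u v - hprod u' v" "hprod u (v - v') = hprod u v - hprod u v'"
  "hprod (- u) v = - hprod u v" "hprod u (- v) = - hprod u v"
  "hprod (c *s u) v = c * hprod u v" "hprod u (c *s v) = cnj c * hprod u v"
  "hprod (r *\<^sub>R u) v = r *\<^sub>R hprod u v" "hprod u (r *\<^sub>R v) = r *\<^sub>R hprod u v"
  "hprod 0 v = 0" "hprod u 0 = 0"
  by (simp_all add: hprod_def algebra_simps sum.distrib sum_subtractf sum_negf sum_distrib_left
      scaleR_sum_right)

lemma hprod_sum:
  "hprod (\<Sum>i\<in>F. f i) v = (\<Sum>i\<in>F. hprod (f i) v)"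
  "hprod u (\<Sum>i\<in>F. f i) = (\<Sum>i\<in>F. hprod u (f i))"
  by (induction F rule: infinite_finite_induct) (simp_all add: hprod_linear)

lemma hprod_commute: "hprod v u = cnj (hprod u v)"
  by (simp add: hprod_def mult.commute)

lemma Re_hprod: "Re (hprod u v) = u \<bullet> v"
  by (simp add: hprod_def inner_vec_def inner_complex_def)

lemma Im_hprod: "Im (hprod u v) = u \<bullet> (\<i> *s v)"
  by (simp add: hprod_def inner_vec_def inner_complex_def)

lemma hprod_self: "hprod u u = of_real ((norm u)\<^sup>2)"
proof (rule complex_eqI)
  show "Re (hprod u u) = Re (of_real ((norm u)\<^sup>2))"
    by (simp add: Re_hprod power2_norm_eq_inner)
  show "Im (hprod u u) = Im (of_real ((norm u)\<^sup>2))"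
    by (simp add: hprod_def complex_mult_cnj)
qed

lemma bounded_bilinear_hprod: "bounded_bilinear hprod"
  by (simp add: bilinear_def hprod_linear linear_iff flip: bilinear_conv_bounded_bilinear)

lemma bounded_bilinear_vector_scalar_mult:
  "bounded_bilinear ((*s) :: complex \<Rightarrow> complex^'n::finite \<Rightarrow> _)"
  by (simp add: bilinear_def linear_iff vec_eq_iff algebra_simps
      flip: bilinear_conv_bounded_bilinear)

lemmas hprod_vector_derivative = bounded_bilinear.has_vector_derivative[OF bounded_bilinear_hprod]

definition unitary_frame :: "(nat \<Rightarrow> complex^'n::finite) \<Rightarrow> bool" where
  "unitary_frame e \<longleftrightarrow>
     (\<forall>j\<in>{1..CARD('n)}. \<forall>k\<in>{1..CARD('n)}. hprod (e j) (e k) = (if j = k then 1 else 0))"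

text \<open>A square matrix whose rows are orthonormal has orthonormal columns, and conversely.\<close>

lemma unitary_frame_iff_columns:
  fixes e :: "nat \<Rightarrow> complex^'n::finite"
  shows "unitary_frame e \<longleftrightarrow>
    (\<forall>a b. (\<Sum>j=1..CARD('n). cnj (e j $ a) * e j $ b) = (if a = b then 1 else 0))"
proof -
  obtain h where h: "bij_betw h {1..CARD('n)} (UNIV :: 'n set)"
    using ex_bij_betw_nat_finite_1[of "UNIV :: 'n set"] by auto
  define g where "g = inv_into {1..CARD('n)} h"
  have g: "bij_betw g UNIV {1..CARD('n)}" using bij_betw_inv_into[OF h] by (simp add: g_def)
  define M :: "complex^'n^'n" where "M = (\<chi> i. e (g i))"
  define M' :: "complex^'n^'n" where "M' = (\<chi> a i. cnj (M $ i $ a))"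
  have rows: "unitary_frame e \<longleftrightarrow> M ** M' = mat 1"
  proof -
    have "M ** M' = mat 1 \<longleftrightarrow> (\<forall>i k. hprod (e (g i)) (e (g k)) = (if i = k then 1 else 0))"
      by (simp add: vec_eq_iff matrix_matrix_mult_def mat_def M_def M'_def hprod_def)
    also have "\<dots> \<longleftrightarrow> (\<forall>i k. hprod (e (g i)) (e (g k)) = (if g i = g k then 1 else 0))"
      using bij_betw_imp_inj_on[OF g] by (simp add: inj_eq)
    also have "\<dots> \<longleftrightarrow> unitary_frame e"
      unfolding unitary_frame_def bij_betw_imp_surj_on[OF g, symmetric] by simp
    finally show ?thesis by simp
  qed
  have "(\<Sum>j=1..CARD('n). cnj (e j $ a) * e j $ b) = (M' ** M) $ a $ b" for a b
    using sum.reindex_bij_betw[OF g, of "\<lambda>j. cnj (e j $ a) * e j $ b"]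
    by (simp add: matrix_matrix_mult_def M_def M'_def)
  then have "(\<forall>a b. (\<Sum>j=1..CARD('n). cnj (e j $ a) * e j $ b) = (if a = b then 1 else 0))
      \<longleftrightarrow> M' ** M = mat 1"
    by (simp add: vec_eq_iff mat_def)
  with rows matrix_left_right_inverse[of M M'] show ?thesis by simp
qed

lemma unitary_frame_expansion:
  fixes e :: "nat \<Rightarrow> complex^'n::finite"
  assumes "unitary_frame e"
  shows "(\<Sum>j=1..CARD('n). hprod v (e j) *s e j) = v"
proof -
  have "(\<Sum>j=1..CARD('n). hprod v (e j) * e j $ b) = v $ b" for b
  proof -
    have "(\<Sum>j=1..CARD('n). hprod v (e j) * e j $ b)
      = (\<Sum>a\<in>UNIV. v $ a * (\<Sum>j=1..CARD('n). cnj (e j $ a) * e j $ b))"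
      unfolding hprod_def sum_distrib_left sum_distrib_right mult.assoc by (rule sum.swap)
    also have "\<dots> = v $ b"
      using assms unfolding unitary_frame_iff_columns
      by (simp add: if_distrib[of "(*) _"] del: split_paired_All cong: if_cong)
    finally show ?thesis .
  qed
  then show ?thesis by (simp add: vec_eq_iff)
qed

section \<open>Frames moving by an anti-Hermitian matrix\<close>

text \<open>The legs are assembled into one vector indexed by the finite type, on which the system is a
  single linear equation.\<close>

lemma moving_frame_exists:
  fixes A :: "real \<Rightarrow> nat \<Rightarrow> nat \<Rightarrow> complex" and e\<^sub>0 :: "nat \<Rightarrow> complex^'n::finite"
  assumes I: "open I" "is_interval I" "s\<^sub>0 \<in> I"
    and A: "\<And>j k. j \<in> {1..CARD('n)} \<Longrightarrow> k \<in> {1..CARD('n)} \<Longrightarrow> continuous_on I (\<lambda>s. A s j k)"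
  obtains e where
    "\<And>j s. j \<in> {1..CARD('n)} \<Longrightarrow> s \<in> I \<Longrightarrow>
      (e j has_vector_derivative (\<Sum>k=1..CARD('n). A s j k *s e k s)) (at s)"
    "\<And>j. j \<in> {1..CARD('n)} \<Longrightarrow> e j s\<^sub>0 = e\<^sub>0 j"
proof -
  obtain h where h: "bij_betw h {1..CARD('n)} (UNIV :: 'n set)"
    using ex_bij_betw_nat_finite_1[of "UNIV :: 'n set"] by auto
  define g where "g = inv_into {1..CARD('n)} h"
  have g: "g i \<in> {1..CARD('n)}" for i
    using bij_betw_apply[OF bij_betw_inv_into[OF h], of i] by (simp add: g_def)
  have gh: "g (h j) = j" if "j \<in> {1..CARD('n)}" for j
    using bij_betw_inv_into_left[OF h that] by (simp add: g_def)
  define F :: "real \<Rightarrow> complex^'n^'n \<Rightarrow> complex^'n^'n" where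
    "F s Y = (\<chi> i. \<Sum>k=1..CARD('n). A s (g i) k *s Y $ h k)" for s Y
  have "linear (F s)" for s
    by (simp add: linear_iff F_def vec_eq_iff sum.distrib algebra_simps scaleR_sum_right)
  then have F: "blinfun_apply (Blinfun (F s)) = F s" for s
    by (simp add: bounded_linear_Blinfun_apply linear_conv_bounded_linear)
  have "continuous_on I (\<lambda>s. F s Y)" for Y
    unfolding F_def using A g
    by (intro continuous_on_vec_lambda continuous_on_sum
        bounded_bilinear.continuous_on[OF bounded_bilinear_vector_scalar_mult] continuous_on_const)
      auto
  then have "continuous_on I (\<lambda>s. Blinfun (F s))"
    by (intro continuous_on_blinfun_componentwise) (simp add: F)
  then obtain y where y: "\<And>s. s \<in> I \<Longrightarrow> (y has_vector_derivative F s (y s)) (at s)"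
    "y s\<^sub>0 = (\<chi> i. e\<^sub>0 (g i))"
    using linear_ODE_solution[OF I, of "\<lambda>s. Blinfun (F s)" "\<chi> i. e\<^sub>0 (g i)"] unfolding F by metis
  show thesis
  proof
    fix j s assume "j \<in> {1..CARD('n)}" "s \<in> I"
    then show "((\<lambda>s. y s $ h j) has_vector_derivative
        (\<Sum>k=1..CARD('n). A s j k *s y s $ h k)) (at s)"
      using bounded_linear.has_vector_derivative[OF bounded_linear_vec_nth y(1)[of s], of "h j"]
      by (simp add: F_def gh)
  next
    fix j assume "j \<in> {1..CARD('n)}"
    then show "y s\<^sub>0 $ h j = e\<^sub>0 j" by (simp add: y(2) gh)
  qed
qed

text \<open>Each order of differentiability of the frame gives one more through the equation.\<close>

lemma moving_frame_smooth:
  fixes e :: "nat \<Rightarrow> real \<Rightarrow> complex^'n::finite"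
  assumes d: "\<And>j s. j \<in> {1..N} \<Longrightarrow> s \<in> I \<Longrightarrow>
      (e j has_vector_derivative (\<Sum>k=1..N. A s j k *s e k s)) (at s)"
    and A: "\<And>j k. j \<in> {1..N} \<Longrightarrow> k \<in> {1..N} \<Longrightarrow> smooth_on I (\<lambda>s. A s j k)"
    and j: "j \<in> {1..N}"
  shows "smooth_on I (e j)"
proof -
  have "\<forall>j\<in>{1..N}. C_on m I (e j)" for m
  proof (induction m)
    case 0
    show ?case unfolding C_on.simps
      by (intro ballI continuous_at_imp_continuous_on) (rule has_vector_derivative_continuous[OF d])
  next
    case (Suc m)
    show ?case
    proof
      fix j assume j: "j \<in> {1..N}"
      have C: "C_on m I (\<lambda>s. \<Sum>k=1..N. A s j k *s e k s)"
        using Suc A j unfolding smooth_on_def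
        by (intro C_on_sum C_on_bilinear[OF bounded_bilinear_vector_scalar_mult]) auto
      show "C_on (Suc m) I (e j)" by (rule C_on_Suc_vector_derivative[OF _ C]) (rule d[OF j])
    qed
  qed
  then show ?thesis using j by (simp add: smooth_on_def)
qed

text \<open>
  Writing two solutions as matrices \<open>M\<close>, \<open>N\<close> with the legs as rows, \<open>M\<^sup>* N\<close> has derivative
  \<open>M\<^sup>* (A\<^sup>* + A) N = 0\<close>. With \<open>M = N\<close> this keeps a frame unitary; with two unitary frames
  \<open>N = M (M\<^sup>* N)\<close> shows that they differ by a fixed unitary matrix.
\<close>

lemma moving_frames_product_constant:
  fixes e f :: "nat \<Rightarrow> real \<Rightarrow> complex^'n::finite"
  assumes I: "is_interval I"
    and de: "\<And>j s. j \<in> {1..N} \<Longrightarrow> s \<in> I \<Longrightarrow>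
      (e j has_vector_derivative (\<Sum>k=1..N. A s j k *s e k s)) (at s)"
    and df: "\<And>j s. j \<in> {1..N} \<Longrightarrow> s \<in> I \<Longrightarrow>
      (f j has_vector_derivative (\<Sum>k=1..N. A s j k *s f k s)) (at s)"
    and A: "\<And>s j k. A s j k = - cnj (A s k j)"
  shows "\<exists>K. \<forall>s\<in>I. \<forall>a b. (\<Sum>j=1..N. cnj (e j s $ a) * f j s $ b) = K a b"
proof -
  have "\<exists>c. \<forall>s\<in>I. (\<Sum>j=1..N. cnj (e j s $ a) * f j s $ b) = c" for a b
  proof -
    have "((\<lambda>s. \<Sum>j=1..N. cnj (e j s $ a) * f j s $ b) has_vector_derivative 0) (at s)"
      if s: "s \<in> I" for s
    proof -
      let ?de = "\<lambda>j. \<Sum>k=1..N. A s j k * e k s $ a" and ?df = "\<lambda>j. \<Sum>k=1..N. A s j k * f k s $ b"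
      have "((\<lambda>s. \<Sum>j=1..N. cnj (e j s $ a) * f j s $ b) has_vector_derivative
          (\<Sum>j=1..N. cnj (e j s $ a) * ?df j + cnj (?de j) * f j s $ b)) (at s)"
      proof (rule has_vector_derivative_sum)
        fix j assume j: "j \<in> {1..N}"
        have "((\<lambda>s. e j s $ a) has_vector_derivative ?de j) (at s)"
          using bounded_linear.has_vector_derivative[OF bounded_linear_vec_nth de[OF j s], of a]
          by simp
        then have 1: "((\<lambda>s. cnj (e j s $ a)) has_vector_derivative cnj (?de j)) (at s)"
          by (rule bounded_linear.has_vector_derivative[OF bounded_linear_cnj])
        have "((\<lambda>s. f j s $ b) has_vector_derivative ?df j) (at s)"
          using bounded_linear.has_vector_derivative[OF bounded_linear_vec_nth df[OF j s], of b]
          by simp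
        with 1 show "((\<lambda>s. cnj (e j s $ a) * f j s $ b) has_vector_derivative
            cnj (e j s $ a) * ?df j + cnj (?de j) * f j s $ b) (at s)"
          by (rule has_vector_derivative_mult)
      qed
      moreover have "(\<Sum>j=1..N. cnj (e j s $ a) * ?df j + cnj (?de j) * f j s $ b) = 0"
      proof -
        have cA: "cnj (A s k j) = - A s j k" for j k by (metis A minus_minus)
        have "(\<Sum>j=1..N. cnj (?de j) * f j s $ b)
          = (\<Sum>j=1..N. \<Sum>k=1..N. cnj (A s j k) * cnj (e k s $ a) * f j s $ b)"
          by (simp add: sum_distrib_right)
        also have "\<dots> = (\<Sum>j=1..N. \<Sum>k=1..N. cnj (A s k j) * cnj (e j s $ a) * f k s $ b)"
          by (rule sum.swap)
        also have "\<dots> = - (\<Sum>j=1..N. cnj (e j s $ a) * ?df j)"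
          by (simp add: cA sum_distrib_left mult_ac flip: sum_negf)
        finally show ?thesis by (simp add: sum.distrib)
      qed
      ultimately show ?thesis by simp
    qed
    then have "((\<lambda>s. \<Sum>j=1..N. cnj (e j s $ a) * f j s $ b) has_vector_derivative 0) (at s within I)"
      if "s \<in> I" for s using that has_vector_derivative_at_within by blast
    from has_vector_derivative_zero_constant[OF is_interval_convex[OF I] this]
    show ?thesis by metis
  qed
  then show ?thesis by metis
qed

text \<open>
  The matrix of \<open>e\<^sub>j' = - \<kappa>\<^bsub>j-1\<^esub> e\<^bsub>j-1\<^esub> + \<kappa>\<^sub>j e\<^bsub>j+1\<^esub>\<close> for \<open>j < n\<close> and
  \<open>e\<^sub>n' = - \<kappa>\<^bsub>n-1\<^esub> e\<^bsub>n-1\<^esub> + \<i> \<kappa>\<^sub>n e\<^sub>n\<close>: since \<open>J\<close> is multiplication by \<open>\<i>\<close>, the component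
  \<open>\<kappa>\<^sub>n\<close> along \<open>e\<^bsub>2n\<^esub> = J e\<^sub>n\<close> becomes an imaginary diagonal entry.
\<close>

definition frenet_matrix :: "nat \<Rightarrow> (nat \<Rightarrow> real) \<Rightarrow> nat \<Rightarrow> nat \<Rightarrow> complex" where
  "frenet_matrix n \<kappa> j k =
     (if k = j + 1 then of_real (\<kappa> j) else if j = k + 1 then - of_real (\<kappa> k)
      else if j = n \<and> k = n then \<i> * of_real (\<kappa> n) else 0)"

lemma frenet_matrix_antihermitian: "frenet_matrix n \<kappa> j k = - cnj (frenet_matrix n \<kappa> k j)"
  by (simp add: frenet_matrix_def)

lemma smooth_frenet_matrix:
  assumes "\<And>j. j \<in> {1..n} \<Longrightarrow> smooth_on I (\<kappa> j)" "j \<in> {1..n}" "k \<in> {1..n}"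
  shows "smooth_on I (\<lambda>s. frenet_matrix n (\<lambda>i. \<kappa> i s) j k)"
proof -
  have "smooth_on I (\<lambda>s. c * complex_of_real (\<kappa> i s))" if "i \<in> {1..n}" for c i
    using bounded_linear_compose[OF bounded_linear_mult_right[of c] bounded_linear_of_real]
    by (rule smooth_on_linear) (rule assms(1)[OF that])
  note * = this[of j 1] this[of k "-1"] this[of n \<i>]
  consider "k = j + 1" | "j = k + 1" | "j = n" "k = n" | "k \<noteq> j + 1" "j \<noteq> k + 1" "\<not> (j = n \<and> k = n)"
    by blast
  then show ?thesis
    by cases (use * assms(2,3) smooth_on_const[of I "0::complex"] in \<open>auto simp: frenet_matrix_def\<close>)
qed

section \<open>The Heisenberg group in complex coordinates\<close>

definition cpx :: "'n::finite heis \<Rightarrow> complex^'n" where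
  "cpx p = (\<chi> j. Complex (fst p $ j) (fst (snd p) $ j))"

definition height :: "'n::finite heis \<Rightarrow> real" where
  "height p = snd (snd p)"

definition of_cpx :: "complex^'n::finite \<Rightarrow> real \<Rightarrow> 'n heis" where
  "of_cpx v z = ((\<chi> j. Re (v $ j)), (\<chi> j. Im (v $ j)), z)"

lemma cpx_of_cpx [simp]: "cpx (of_cpx v z) = v" "height (of_cpx v z) = z"
  by (simp_all add: cpx_def height_def of_cpx_def vec_eq_iff)

lemma of_cpx_cpx [simp]: "of_cpx (cpx p) (height p) = p"
  by (simp add: cpx_def height_def of_cpx_def prod_eq_iff vec_eq_iff)

lemma heis_eqI: "cpx p = cpx q \<Longrightarrow> height p = height q \<Longrightarrow> p = q"
  by (metis of_cpx_cpx)

lemma linear_cpx: "linear cpx" and linear_height: "linear height"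
  by (auto simp: linear_iff cpx_def height_def vec_eq_iff complex_eq_iff)

lemmas bounded_linear_cpx = linear_cpx[unfolded linear_conv_bounded_linear]
lemmas bounded_linear_height = linear_height[unfolded linear_conv_bounded_linear]
lemmas cpx_linear = linear_add[OF linear_cpx] linear_diff[OF linear_cpx]
  linear_scale[OF linear_cpx] linear_0[OF linear_cpx] linear_neg[OF linear_cpx]
lemmas height_linear = linear_add[OF linear_height] linear_diff[OF linear_height]
  linear_scale[OF linear_height] linear_0[OF linear_height] linear_neg[OF linear_height]

lemma bounded_linear_of_cpx_fst: "bounded_linear (\<lambda>v. of_cpx v 0)"
  by (simp add: linear_iff of_cpx_def vec_eq_iff flip: linear_conv_bounded_linear)

lemma bounded_linear_of_cpx_snd: "bounded_linear (\<lambda>z. of_cpx 0 z)"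
  by (simp add: linear_iff of_cpx_def vec_eq_iff flip: linear_conv_bounded_linear)

lemma of_cpx_split: "of_cpx v z = of_cpx v 0 + of_cpx 0 z"
  by (simp add: of_cpx_def vec_eq_iff)

lemma smooth_on_of_cpx:
  "smooth_on S f \<Longrightarrow> smooth_on S g \<Longrightarrow> smooth_on S (\<lambda>s. of_cpx (f s) (g s))"
  unfolding of_cpx_split[of "f _" "g _"]
  by (intro smooth_on_add smooth_on_linear[OF bounded_linear_of_cpx_fst]
      smooth_on_linear[OF bounded_linear_of_cpx_snd])

lemma of_cpx_vector_derivative:
  assumes "(f has_vector_derivative f') F" "(g has_vector_derivative g') F"
  shows "((\<lambda>s. of_cpx (f s) (g s)) has_vector_derivative of_cpx f' g') F"
  unfolding of_cpx_split[of "f _" "g _"] of_cpx_split[of f' g']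
  by (intro has_vector_derivative_add assms
      bounded_linear.has_vector_derivative[OF bounded_linear_of_cpx_fst]
      bounded_linear.has_vector_derivative[OF bounded_linear_of_cpx_snd])

lemma theta_cpx: "theta p v = height v - Im (hprod (cpx p) (cpx v))"
  by (cases p; cases v)
    (simp add: theta_def height_def cpx_def hprod_def algebra_simps sum_subtractf)

lemma levi_cpx: "levi p u v = cpx u \<bullet> cpx v + theta p u * theta p v"
  by (cases u; cases v)
    (simp add: levi_def cpx_def inner_vec_def inner_complex_def)

text \<open>The contact vector with given complex coordinates: \<open>\<theta> = 0\<close> determines its height.\<close>

definition lift :: "'n::finite heis \<Rightarrow> complex^'n \<Rightarrow> 'n heis" where
  "lift p v = of_cpx v (Im (hprod (cpx p) v))"

lemma cpx_lift [simp]: "cpx (lift p v) = v"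
  and theta_lift [simp]: "theta p (lift p v) = 0"
  and height_lift: "height (lift p v) = Im (hprod (cpx p) v)"
  by (simp_all add: lift_def theta_cpx)

lemma linear_lift: "linear (lift p)"
  by (rule linearI; rule heis_eqI) (simp_all add: cpx_linear height_linear height_lift hprod_linear)

lemma lift_eq_0_iff [simp]: "lift p v = 0 \<longleftrightarrow> v = 0"
  by (metis cpx_lift cpx_linear(4) linear_0 linear_lift)

text \<open>
  With this lemma and the next, contact parts and \<open>J\<close> turn into the identity and multiplication by
  \<open>\<i>\<close> in complex coordinates.
\<close>

lemma contact_part_lift: "contact_part p v = lift p (cpx v)"
proof (rule heis_eqI)
  have T: "cpx T_field = 0" "height T_field = 1"
    by (simp_all add: cpx_def height_def T_field_def vec_eq_iff complex_eq_iff)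
  have "contact_part p v = v - theta p v *\<^sub>R T_field"
    using vector_decomposition[of v p] by (simp add: algebra_simps)
  then show "cpx (contact_part p v) = cpx (lift p (cpx v))"
    "height (contact_part p v) = height (lift p (cpx v))"
    by (simp_all add: cpx_linear height_linear T height_lift theta_cpx)
qed

lemma J_lift: "J p v = lift p (\<i> *s cpx v)"
proof -
  obtain x y z where p: "p = (x, y, z)" by (cases p) auto
  obtain a b c where v: "v = (a, b, c)" by (cases v) auto
  have "fst (J p v) = - b" "fst (snd (J p v)) = a"
    by (simp_all add: J_def X_field_def Y_field_def p v fst_sum snd_sum vec_eq_iff
        axis_def if_distrib sum_negf cong: if_cong)
  then have c: "cpx (J p v) = \<i> *s cpx v"
    by (simp add: cpx_def v vec_eq_iff complex_eq_iff)
  have "snd (snd (J p v)) = - (\<Sum>j\<in>UNIV. x $ j * a $ j + y $ j * b $ j)"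
    by (simp add: J_def X_field_def Y_field_def p v snd_sum algebra_simps
        flip: sum_negf)
  then have "height (J p v) = Im (hprod (cpx p) (\<i> *s cpx v))"
    by (simp add: cpx_def height_def hprod_def p v sum_negf[symmetric])
  with c show ?thesis by (intro heis_eqI) (simp_all add: height_lift)
qed

lemma contact_eq_ker_theta: "contact p = {v. theta p v = 0}"
proof
  have "subspace {v. theta p v = 0}"
    by (auto simp: subspace_def theta_cpx cpx_linear height_linear hprod_linear algebra_simps)
  then show "contact p \<subseteq> {v. theta p v = 0}"
    unfolding contact_def by (intro span_minimal) (auto simp: theta_fields)
  show "{v. theta p v = 0} \<subseteq> contact p"
  proof
    fix v assume "v \<in> {v. theta p v = 0}"
    then have "v = contact_part p v" using vector_decomposition[of v p] by simp
    also have "\<dots> \<in> contact p"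
      unfolding contact_part_def contact_def
      by (auto intro!: span_sum span_add span_scale intro: span_base split: prod.splits)
    finally show "v \<in> contact p" .
  qed
qed

lemma contact_eq_range_lift: "contact p = range (lift p)"
proof -
  have "v = lift p (cpx v)" if "theta p v = 0" for v
    using that vector_decomposition[of v p] by (simp add: contact_part_lift)
  then show ?thesis by (auto simp: contact_eq_ker_theta)
qed

section \<open>Rigid motions from unitary maps\<close>

text \<open>The derivative is constant, so every order follows from the first.\<close>

lemma smooth_on_affine:
  assumes "linear h"
  shows "smooth_on S (\<lambda>x. h x + c)"
  unfolding smooth_on_def
proof
  fix k
  have h: "bounded_linear h" using assms by (simp add: linear_conv_bounded_linear)
  have "((\<lambda>x. h x + c) has_derivative h) (at x)" for x
    using has_derivative_add[OF bounded_linear_imp_has_derivative[OF h] has_derivative_const]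
    by simp
  then have "C_on (Suc k) S (\<lambda>x. h x + c)"
    by (auto intro!: exI[of _ "\<lambda>_. h"] C_on_const)
  then show "C_on k S (\<lambda>x. h x + c)" by (rule C_on_Suc_imp)
qed

definition rigid_motion ::
  "(complex^'n::finite \<Rightarrow> complex^'n) \<Rightarrow> complex^'n \<Rightarrow> real \<Rightarrow> 'n heis \<Rightarrow> 'n heis" where
  "rigid_motion W a b p =
     of_cpx (W (cpx p) + a) (height p + Im (hprod a (W (cpx p))) + b)"

text \<open>
  In complex coordinates \<open>\<theta>\<^bsub>p\<^esub>(v)\<close> is \<open>height v - Im \<langle>p, v\<rangle>\<close>, so a unitary map followed by a
  left translation preserves it; both are affine, with complex linear contact part.
\<close>

lemma rigid_motion_in_PSH:
  fixes W W' :: "complex^'n::finite \<Rightarrow> complex^'n"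
  assumes W: "linear W" "\<And>v. W (\<i> *s v) = \<i> *s W v" "\<And>u v. hprod (W u) (W v) = hprod u v"
    and W': "linear W'" "\<And>v. W (W' v) = v" "\<And>v. W' (W v) = v"
  shows "rigid_motion W a b \<in> PSH"
proof -
  let ?\<Phi> = "rigid_motion W a b"
  define D where "D p = of_cpx (W (cpx p)) (height p + Im (hprod a (W (cpx p))))" for p
  define D' where "D' p = of_cpx (W' (cpx p)) (height p - Im (hprod a (cpx p)))" for p
  define c where "c = of_cpx a b"
  define \<Psi> where "\<Psi> q = D' q + (- D' c)" for q
  note W_lin = linear_add[OF W(1)] linear_scale[OF W(1)]
  note W'_lin = linear_add[OF W'(1)] linear_scale[OF W'(1)]
  have \<Phi>: "?\<Phi> = (\<lambda>p. D p + c)"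
    by (rule ext, rule heis_eqI)
      (simp_all add: rigid_motion_def D_def c_def cpx_linear height_linear)
  have linD: "linear D"
    by (rule linearI; rule heis_eqI)
      (simp_all add: D_def cpx_linear height_linear W_lin hprod_linear algebra_simps)
  have linD': "linear D'"
    by (rule linearI; rule heis_eqI)
      (simp_all add: D'_def cpx_linear height_linear W'_lin hprod_linear algebra_simps)
  have DD': "D (D' q) = q" "D' (D q) = q" for q
    by (rule heis_eqI; simp add: D_def D'_def W')+
  have \<Psi>: "?\<Phi> (\<Psi> q) = q" "\<Psi> (?\<Phi> q) = q" for q
    by (simp_all add: \<Phi> \<Psi>_def linear_add[OF linD] linear_add[OF linD'] linear_diff[OF linD]
        linear_diff[OF linD'] DD')
  have inv: "inv ?\<Phi> = \<Psi>" by (rule inv_equality) (simp_all add: \<Psi>)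
  have "bij ?\<Phi>" by (rule bij_betw_byWitness[where f' = \<Psi>]) (auto simp: \<Psi>)
  moreover have "smooth_on UNIV ?\<Phi>" unfolding \<Phi> by (rule smooth_on_affine[OF linD])
  moreover have "smooth_on UNIV (inv ?\<Phi>)"
    unfolding inv \<Psi>_def[abs_def] by (rule smooth_on_affine[OF linD'])
  moreover have fd: "frechet_derivative ?\<Phi> (at p) = D" for p
  proof -
    have "bounded_linear D" using linD by (simp add: linear_conv_bounded_linear)
    then have "(?\<Phi> has_derivative D) (at p)"
      unfolding \<Phi>
      using has_derivative_add[OF bounded_linear_imp_has_derivative has_derivative_const] by force
    then show ?thesis by (rule frechet_derivative_at[symmetric])
  qed
  moreover have th: "theta (?\<Phi> p) (D v) = theta p v" for p v
    by (simp add: theta_cpx rigid_motion_def D_def hprod_linear W(3))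
  moreover have "D ` contact p = contact (?\<Phi> p)" for p
  proof
    show "D ` contact p \<subseteq> contact (?\<Phi> p)" by (auto simp: contact_eq_ker_theta th)
    show "contact (?\<Phi> p) \<subseteq> D ` contact p"
    proof
      fix v assume "v \<in> contact (?\<Phi> p)"
      then have "D' v \<in> contact p"
        using th[of p "D' v"] by (simp add: contact_eq_ker_theta DD')
      then show "v \<in> D ` contact p" using DD'(1)[of v] by (metis image_eqI)
    qed
  qed
  moreover have "D (J p v) = J (?\<Phi> p) (D v)" for p v
  proof (rule heis_eqI)
    show "cpx (D (J p v)) = cpx (J (?\<Phi> p) (D v))" by (simp add: D_def J_lift W(2))
    show "height (D (J p v)) = height (J (?\<Phi> p) (D v))"
      using th[of p "J p v"] by (simp add: D_def J_lift W(2,3) theta_cpx height_lift rigid_motion_def hprod_linear)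
  qed
  ultimately show ?thesis unfolding PSH_def by simp
qed

section \<open>Wedge products of triangular families\<close>

lemma levi_left_linear:
  "levi p (u + u') v = levi p u v + levi p u' v" "levi p (r *\<^sub>R u) v = r * levi p u v"
  "levi p 0 v = 0"
  by (simp_all add: levi_cpx theta_cpx cpx_linear height_linear hprod_linear inner_add_left
      algebra_simps)

lemma levi_sum_left: "levi p (\<Sum>l\<in>F. c l *\<^sub>R u l) v = (\<Sum>l\<in>F. c l * levi p (u l) v)"
  by (induction F rule: infinite_finite_induct) (simp_all add: levi_left_linear)

lemma wedge_cong: "(\<And>i. i \<in> {1..j} \<Longrightarrow> v i = v' i) \<Longrightarrow> wedge p j v = wedge p j v'"
  unfolding wedge_def by (intro ext sum.cong arg_cong2[of _ _ _ _ "(*)"] prod.cong) simp_all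

text \<open>The sum over permutations collapses to the identity once every other term has a zero factor.\<close>

lemma wedge_diagonal:
  assumes "\<And>\<sigma>. \<sigma> permutes {1..j} \<Longrightarrow> \<sigma> \<noteq> id \<Longrightarrow> \<exists>i\<in>{1..j}. levi p (v i) (w (\<sigma> i)) = 0"
  shows "wedge p j v w = (\<Prod>i=1..j. levi p (v i) (w i))"
proof -
  have "(\<Prod>i=1..j. levi p (v i) (w (\<sigma> i))) = 0" if "\<sigma> permutes {1..j}" "\<sigma> \<noteq> id" for \<sigma>
    using assms[OF that] by (intro prod_zero) auto
  then have "wedge p j v w = (\<Sum>\<sigma>\<in>{id}. of_int (sign \<sigma>) * (\<Prod>i=1..j. levi p (v i) (w (\<sigma> i))))"
    unfolding wedge_def
    by (intro sum.mono_neutral_right finite_permutations) (auto simp: permutes_id)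
  then show ?thesis by (simp add: sign_id)
qed

lemma wedge_lower_triangular:
  assumes "\<And>i k. i \<in> {1..j} \<Longrightarrow> k \<in> {1..j} \<Longrightarrow> i < k \<Longrightarrow> levi p (v i) (w k) = 0"
  shows "wedge p j v w = (\<Prod>i=1..j. levi p (v i) (w i))"
proof (rule wedge_diagonal)
  fix \<sigma> assume \<sigma>: "\<sigma> permutes {1..j}" "\<sigma> \<noteq> id"
  then obtain i where "i \<in> {1..j}" "i < \<sigma> i"
    using permutes_natset_le[OF \<sigma>(1)] not_le by blast
  then show "\<exists>i\<in>{1..j}. levi p (v i) (w (\<sigma> i)) = 0"
    using assms permutes_in_image[OF \<sigma>(1)] by blast
qed

lemma wedge_upper_triangular:
  assumes "\<And>i k. i \<in> {1..j} \<Longrightarrow> k \<in> {1..j} \<Longrightarrow> k < i \<Longrightarrow> levi p (v i) (w k) = 0"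
  shows "wedge p j v w = (\<Prod>i=1..j. levi p (v i) (w i))"
proof (rule wedge_diagonal)
  fix \<sigma> assume \<sigma>: "\<sigma> permutes {1..j}" "\<sigma> \<noteq> id"
  then obtain i where "i \<in> {1..j}" "\<sigma> i < i"
    using permutes_natset_ge[OF \<sigma>(1)] not_le by blast
  then show "\<exists>i\<in>{1..j}. levi p (v i) (w (\<sigma> i)) = 0"
    using assms permutes_in_image[OF \<sigma>(1)] by blast
qed

text \<open>Composition with the transposition of the two places pairs off terms of opposite sign.\<close>

lemma wedge_repeated:
  assumes ab: "a \<in> {1..j}" "b \<in> {1..j}" "a \<noteq> b" "v a = v b"
  shows "wedge p j v w = 0"
proof -
  let ?\<tau> = "Transposition.transpose a b"
  let ?F = "\<lambda>\<sigma>. of_int (sign \<sigma>) * (\<Prod>i=1..j. levi p (v i) (w (\<sigma> i)))"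
  have \<tau>: "?\<tau> permutes {1..j}" using ab by (intro permutes_swap_id) auto
  have flip: "?F (\<sigma> \<circ> ?\<tau>) = - ?F \<sigma>" if \<sigma>: "\<sigma> permutes {1..j}" for \<sigma>
  proof -
    have "permutation \<sigma>" "permutation ?\<tau>"
      using \<sigma> \<tau> by (meson finite_atLeastAtMost permutation_permutes)+
    then have "sign (\<sigma> \<circ> ?\<tau>) = - sign \<sigma>"
      using ab(3) by (simp add: sign_compose sign_swap_id)
    moreover have "(\<Prod>i=1..j. levi p (v i) (w (\<sigma> i))) = (\<Prod>i=1..j. levi p (v i) (w ((\<sigma> \<circ> ?\<tau>) i)))"
      unfolding prod.permute[OF \<tau>, of "\<lambda>i. levi p (v i) (w (\<sigma> i))"]
      using ab(4) by (intro prod.cong) (auto simp: Transposition.transpose_def)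
    ultimately show ?thesis by simp
  qed
  have "wedge p j v w = (\<Sum>\<sigma> | \<sigma> permutes {1..j}. ?F (\<sigma> \<circ> ?\<tau>))"
    unfolding wedge_def
    by (rule sum.reindex_bij_witness[of _ "\<lambda>\<sigma>. \<sigma> \<circ> ?\<tau>" "\<lambda>\<sigma>. \<sigma> \<circ> ?\<tau>"])
      (auto simp: o_assoc[symmetric] intro!: permutes_compose[OF \<tau>])
  also have "\<dots> = - wedge p j v w"
    unfolding wedge_def sum_negf[symmetric] using flip by (intro sum.cong) auto
  finally show ?thesis by simp
qed

lemma wedge_sum_at:
  assumes a: "a \<in> {1..j}"
  shows "wedge p j (v(a := \<Sum>l\<in>F. c l *\<^sub>R u l)) w = (\<Sum>l\<in>F. c l * wedge p j (v(a := u l)) w)"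
proof -
  have "wedge p j (v(a := x)) w = (\<Sum>\<sigma> | \<sigma> permutes {1..j}. of_int (sign \<sigma>) *
      (levi p x (w (\<sigma> a)) * (\<Prod>i\<in>{1..j} - {a}. levi p (v i) (w (\<sigma> i)))))" for x
    unfolding wedge_def using a by (simp add: prod.remove[of "{1..j}" a])
  then show ?thesis
    by (simp add: levi_sum_left sum_distrib_left sum_distrib_right mult_ac)
      (rule sum.swap)
qed

text \<open>
  Replacing the vectors one at a time from the first: the terms of \<open>v\<^sub>m\<close> in \<open>e\<^sub>1, \<dots>, e\<^bsub>m-1\<^esub>\<close>
  repeat a factor that is already there.
\<close>

lemma wedge_triangular_combination:
  assumes v: "\<And>i. i \<in> {1..j} \<Longrightarrow> v i = (\<Sum>l=1..i. T i l *\<^sub>R e l)"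
  shows "wedge p j v w = (\<Prod>i=1..j. T i i) * wedge p j e w"
proof -
  define g where "g m i = (if i \<le> m then e i else v i)" for m i
  have "m \<le> j \<Longrightarrow> wedge p j v w = (\<Prod>i=1..m. T i i) * wedge p j (g m) w" for m
  proof (induction m)
    case 0
    have "wedge p j v = wedge p j (g 0)" by (rule wedge_cong) (simp add: g_def)
    then show ?case by simp
  next
    case (Suc m)
    then have m: "Suc m \<in> {1..j}" by simp
    let ?h = "g (Suc m)"
    have "g m = ?h(Suc m := v (Suc m))" by (auto simp: g_def le_Suc_eq)
    then have "wedge p j (g m) w = (\<Sum>l=1..Suc m. T (Suc m) l * wedge p j (?h(Suc m := e l)) w)"
      unfolding v[OF m] by (simp only: wedge_sum_at[OF m])
    also have "\<dots> = (\<Sum>l\<in>{Suc m}. T (Suc m) l * wedge p j (?h(Suc m := e l)) w)"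
    proof (rule sum.mono_neutral_right)
      show "\<forall>l\<in>{1..Suc m} - {Suc m}. T (Suc m) l * wedge p j (?h(Suc m := e l)) w = 0"
      proof
        fix l assume "l \<in> {1..Suc m} - {Suc m}"
        then have "wedge p j (?h(Suc m := e l)) w = 0"
          using m by (intro wedge_repeated[of l j "Suc m"]) (auto simp: g_def)
        then show "T (Suc m) l * wedge p j (?h(Suc m := e l)) w = 0" by simp
      qed
    qed auto
    also have "\<dots> = T (Suc m) (Suc m) * wedge p j ?h w"
    proof -
      have "?h(Suc m := e (Suc m)) = ?h" by (auto simp: g_def)
      then show ?thesis by simp
    qed
    finally show ?case using Suc by simp
  qed
  from this[of j] have "wedge p j v w = (\<Prod>i=1..j. T i i) * wedge p j (g j) w" by simp
  moreover have "wedge p j (g j) = wedge p j e" by (rule wedge_cong) (simp add: g_def)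
  ultimately show ?thesis by simp
qed

section \<open>Adapted frames and triangular jets\<close>

lemma of_real_vector_scalar_mult: "complex_of_real r *s v = r *\<^sub>R v"
  by (simp add: vec_eq_iff complex_eq_iff)

lemma levi_lift_right: "levi p u (lift p v) = cpx u \<bullet> v"
  by (simp add: levi_cpx)

lemma unitary_frame_inner:
  fixes e :: "nat \<Rightarrow> complex^'n::finite"
  assumes "unitary_frame e" "j \<in> {1..CARD('n)}" "k \<in> {1..CARD('n)}"
  shows "e j \<bullet> e k = (if j = k then 1 else 0)" "e j \<bullet> (\<i> *s e k) = 0"
proof -
  have "hprod (e j) (e k) = (if j = k then 1 else 0)"
    using assms by (simp add: unitary_frame_def)
  then show "e j \<bullet> e k = (if j = k then 1 else 0)" "e j \<bullet> (\<i> *s e k) = 0"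
    using Re_hprod[of "e j" "e k"] Im_hprod[of "e j" "e k"] by (auto split: if_splits)
qed

text \<open>
  Orthogonality of \<open>e\<^sub>j\<close> to \<open>e\<^bsub>n+k\<^esub> = J e\<^sub>k\<close> is the vanishing of the imaginary part of
  \<open>\<langle>e\<^sub>j, e\<^sub>k\<rangle>\<close>, so the real orthonormality of the \<open>2n\<close> legs is the unitarity of the first \<open>n\<close>.
\<close>

lemma oriented_frame_unitary:
  fixes e :: "nat \<Rightarrow> 'n::finite heis"
  assumes "oriented_frame p e"
  shows "unitary_frame (\<lambda>j. cpx (e j))"
    and "\<And>j. j \<in> {1..2 * CARD('n)} \<Longrightarrow> e j = lift p (cpx (e j))"
    and "\<And>j. j \<in> {1..CARD('n)} \<Longrightarrow> cpx (e (CARD('n) + j)) = \<i> *s cpx (e j)"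
proof -
  let ?n = "CARD('n)"
  have orth: "levi p (e i) (e j) = (if i = j then 1 else 0)"
    if "i \<in> {1..2 * ?n}" "j \<in> {1..2 * ?n}" for i j
    using assms that unfolding oriented_frame_def by blast
  have J: "e (?n + j) = J p (e j)" if "j \<in> {1..?n}" for j
    using assms that unfolding oriented_frame_def by blast
  have "e j \<in> contact p" if "j \<in> {1..2 * ?n}" for j
    using assms that span_base[of "e j" "e ` {1..2 * ?n}"] unfolding oriented_frame_def by blast
  then show lift: "e j = lift p (cpx (e j))" if "j \<in> {1..2 * ?n}" for j
    using that unfolding contact_eq_range_lift by fastforce
  show iJ: "cpx (e (?n + j)) = \<i> *s cpx (e j)" if "j \<in> {1..?n}" for j
    using J[OF that] by (simp add: J_lift)
  have inner: "levi p (e i) (e j) = cpx (e i) \<bullet> cpx (e j)" if "j \<in> {1..2 * ?n}" for i j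
    using lift[OF that] levi_lift_right by metis
  show "unitary_frame (\<lambda>j. cpx (e j))"
    unfolding unitary_frame_def
  proof (intro ballI complex_eqI)
    fix j k assume j: "j \<in> {1..?n}" and k: "k \<in> {1..?n}"
    then have *: "j \<in> {1..2 * ?n}" "k \<in> {1..2 * ?n}" "?n + k \<in> {1..2 * ?n}" "j \<noteq> ?n + k"
      by auto
    show "Re (hprod (cpx (e j)) (cpx (e k))) = Re (if j = k then 1 else 0)"
      using orth[OF *(1,2)] inner[OF *(2), of j] by (simp add: Re_hprod)
    show "Im (hprod (cpx (e j)) (cpx (e k))) = Im (if j = k then 1 else 0)"
      using orth[OF *(1,3)] inner[OF *(3), of j] *(4) iJ[OF k] by (simp add: Im_hprod)
  qed
qed

text \<open>All \<open>2n\<close> legs in complex coordinates, from the first \<open>n\<close>.\<close>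

definition oriented_legs :: "(nat \<Rightarrow> complex^'n::finite) \<Rightarrow> nat \<Rightarrow> complex^'n" where
  "oriented_legs f j = (if j \<le> CARD('n) then f j else \<i> *s f (j - CARD('n)))"

lemma oriented_frame_lift:
  fixes f :: "nat \<Rightarrow> complex^'n::finite"
  assumes f: "unitary_frame f"
  shows "oriented_frame p (\<lambda>j. lift p (oriented_legs f j))"
proof -
  let ?n = "CARD('n)" and ?e = "\<lambda>j. lift p (oriented_legs f j)"
  have h: "hprod (f j) (f k) = (if j = k then 1 else 0)" if "j \<in> {1..?n}" "k \<in> {1..?n}" for j k
    using f that unfolding unitary_frame_def by blast
  have orth: "levi p (?e i) (?e j) = (if i = j then 1 else 0)"
    if i: "i \<in> {1..2 * ?n}" and j: "j \<in> {1..2 * ?n}" for i j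
  proof -
    have "Re (hprod (oriented_legs f i) (oriented_legs f j)) = (if i = j then 1 else 0)"
    proof -
      have "i \<le> ?n \<Longrightarrow> i \<in> {1..?n}" "\<not> i \<le> ?n \<Longrightarrow> i - ?n \<in> {1..?n}"
        "j \<le> ?n \<Longrightarrow> j \<in> {1..?n}" "\<not> j \<le> ?n \<Longrightarrow> j - ?n \<in> {1..?n}"
        "\<not> i \<le> ?n \<Longrightarrow> \<not> j \<le> ?n \<Longrightarrow> i - ?n = j - ?n \<longleftrightarrow> i = j"
        using i j by auto
      then show ?thesis
        by (cases "i \<le> ?n"; cases "j \<le> ?n")
          (auto simp: oriented_legs_def hprod_linear h simp del: atLeastAtMost_iff)
    qed
    then show ?thesis by (simp add: levi_lift_right Re_hprod)
  qed
  have "span (?e ` {1..2 * ?n}) = contact p"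
  proof
    show "span (?e ` {1..2 * ?n}) \<subseteq> contact p"
      unfolding contact_def
      by (intro span_minimal subspace_span)
        (auto simp: contact_eq_range_lift simp flip: contact_def)
    show "contact p \<subseteq> span (?e ` {1..2 * ?n})"
    proof
      fix x assume "x \<in> contact p"
      then obtain v where x: "x = lift p v" by (auto simp: contact_eq_range_lift)
      have "c *s f j = Re c *\<^sub>R oriented_legs f j + Im c *\<^sub>R oriented_legs f (?n + j)"
        if "j \<in> {1..?n}" for c j
        using that by (simp add: oriented_legs_def vec_eq_iff complex_eq_iff)
      then have v: "v = (\<Sum>j=1..?n. Re (hprod v (f j)) *\<^sub>R oriented_legs f j +
          Im (hprod v (f j)) *\<^sub>R oriented_legs f (?n + j))"
        by (subst unitary_frame_expansion[OF f, symmetric]) (rule sum.cong[OF refl])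
      have "x = lift p (\<Sum>j=1..?n. Re (hprod v (f j)) *\<^sub>R oriented_legs f j +
          Im (hprod v (f j)) *\<^sub>R oriented_legs f (?n + j))"
        unfolding x by (rule arg_cong[OF v])
      also have "\<dots> = (\<Sum>j=1..?n. Re (hprod v (f j)) *\<^sub>R ?e j + Im (hprod v (f j)) *\<^sub>R ?e (?n + j))"
        by (simp only: linear_sum[OF linear_lift] linear_add[OF linear_lift] linear_scale[OF linear_lift])
      also have "\<dots> \<in> span (?e ` {1..2 * ?n})"
        by (intro span_sum span_add span_scale span_base imageI) auto
      finally show "x \<in> span (?e ` {1..2 * ?n})" .
    qed
  qed
  moreover have "?e (?n + j) = J p (?e j)" if "j \<in> {1..?n}" for j
    using that by (simp add: J_lift oriented_legs_def)
  ultimately show ?thesis using orth unfolding oriented_frame_def by blast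
qed

text \<open>
  The vectors \<open>c\<^sub>1, \<dots>, c\<^sub>n\<close> have a real lower triangular matrix with nonzero diagonal entries
  with respect to the unitary frame \<open>e\<close>: the condition on the wedge products in the definition
  of an adapted frame, in coordinates.
\<close>

definition triangular :: "(nat \<Rightarrow> complex^'n::finite) \<Rightarrow> (nat \<Rightarrow> complex^'n) \<Rightarrow> bool" where
  "triangular c e \<longleftrightarrow> (\<forall>k\<in>{1..CARD('n)}.
     (\<forall>i\<in>{1..CARD('n)}. Im (hprod (c k) (e i)) = 0 \<and> (k < i \<longrightarrow> hprod (c k) (e i) = 0)) \<and>
     hprod (c k) (e k) \<noteq> 0)"

lemma triangular_row:
  fixes e :: "nat \<Rightarrow> complex^'n::finite"
  assumes e: "unitary_frame e" and k: "k \<in> {1..CARD('n)}"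
    and c: "\<And>i. i \<in> {1..CARD('n)} \<Longrightarrow> Im (hprod c (e i)) = 0"
      "\<And>i. i \<in> {1..CARD('n)} \<Longrightarrow> k < i \<Longrightarrow> hprod c (e i) = 0"
  shows "c = (\<Sum>l=1..k. (c \<bullet> e l) *\<^sub>R e l)"
proof -
  have "c = (\<Sum>l=1..CARD('n). hprod c (e l) *s e l)" by (rule unitary_frame_expansion[OF e, symmetric])
  also have "\<dots> = (\<Sum>l=1..k. hprod c (e l) *s e l)"
    using k c(2) by (intro sum.mono_neutral_right) (auto simp: vec_eq_iff)
  also have "\<dots> = (\<Sum>l=1..k. (c \<bullet> e l) *\<^sub>R e l)"
  proof (intro sum.cong refl)
    fix l assume "l \<in> {1..k}"
    then have "hprod c (e l) = complex_of_real (c \<bullet> e l)"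
      using c(1)[of l] k by (simp add: complex_eq_iff Re_hprod)
    then show "hprod c (e l) *s e l = (c \<bullet> e l) *\<^sub>R e l" by (simp add: of_real_vector_scalar_mult)
  qed
  finally show ?thesis .
qed

lemma triangular_combination:
  fixes e :: "nat \<Rightarrow> complex^'n::finite"
  assumes "triangular c e" "unitary_frame e" "k \<in> {1..CARD('n)}"
  shows "c k = (\<Sum>l=1..k. (c k \<bullet> e l) *\<^sub>R e l)" "c k \<bullet> e k \<noteq> 0"
proof -
  have *: "Im (hprod (c k) (e i)) = 0" "k < i \<Longrightarrow> hprod (c k) (e i) = 0"
    "hprod (c k) (e k) \<noteq> 0"
    if "i \<in> {1..CARD('n)}" for i
    using assms(1,3) that unfolding triangular_def by blast+
  then show "c k = (\<Sum>l=1..k. (c k \<bullet> e l) *\<^sub>R e l)"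
    using assms(2,3) by (intro triangular_row) auto
  show "c k \<bullet> e k \<noteq> 0" using *(1,3)[OF assms(3)] by (simp add: complex_eq_iff Re_hprod)
qed

lemma triangular_orthogonal:
  fixes e :: "nat \<Rightarrow> complex^'n::finite"
  assumes "triangular c e" "k \<in> {1..CARD('n)}" "i \<in> {1..CARD('n)}" "k < i"
  shows "c k \<bullet> e i = 0"
  using assms by (simp add: triangular_def flip: Re_hprod)

text \<open>
  The wedge product of the triangular family is \<open>P = \<Prod>\<^sub>i \<langle>c\<^sub>i, e\<^sub>i\<rangle>\<close> times that of the frame,
  hence of norm \<open>\<bar>P\<bar>\<close>, and the sign in the definition of an adapted frame is that of \<open>P\<close>.
\<close>

lemma wedge_triangular_legs:
  fixes e :: "nat \<Rightarrow> complex^'n::finite"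
  assumes T: "triangular c e" and e: "unitary_frame e" and j: "j \<in> {1..CARD('n)}"
  shows "wedge p j (\<lambda>k. lift p (c k)) (\<lambda>k. lift p (e k)) = (\<Prod>i=1..j. c i \<bullet> e i)"
    and "\<exists>\<epsilon>\<in>{1, -1}. wedge p j (\<lambda>i. lift p (e i)) =
      (\<lambda>w. \<epsilon> * (wedge p j (\<lambda>k. lift p (c k)) w / wedge_norm p j (\<lambda>k. lift p (c k))))"
proof -
  define P where "P = (\<Prod>i=1..j. c i \<bullet> e i)"
  have in_n: "i \<in> {1..CARD('n)}" if "i \<in> {1..j}" for i using that j by simp
  have P0: "P \<noteq> 0"
    unfolding P_def using triangular_combination(2)[OF T e in_n] by simp
  have orth: "c i \<bullet> e k = 0" if "i \<in> {1..j}" "k \<in> {1..j}" "i < k" for i k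
    using triangular_orthogonal[OF T in_n[OF that(1)] in_n[OF that(2)] that(3)] .
  show "wedge p j (\<lambda>k. lift p (c k)) (\<lambda>k. lift p (e k)) = P"
    unfolding P_def by (subst wedge_lower_triangular) (simp_all add: levi_lift_right orth)
  have comb: "wedge p j (\<lambda>k. lift p (c k)) w = P * wedge p j (\<lambda>k. lift p (e k)) w" for w
    unfolding P_def
  proof (rule wedge_triangular_combination[where T = "\<lambda>i l. c i \<bullet> e l"])
    fix i assume i: "i \<in> {1..j}"
    show "lift p (c i) = (\<Sum>l=1..i. (c i \<bullet> e l) *\<^sub>R lift p (e l))"
      by (subst triangular_combination(1)[OF T e in_n[OF i]])
        (simp add: linear_sum[OF linear_lift] linear_scale[OF linear_lift])
  qed
  have "wedge p j (\<lambda>k. lift p (e k)) (\<lambda>k. lift p (c k)) = P"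
    unfolding P_def
    by (subst wedge_upper_triangular) (simp_all add: levi_lift_right orth inner_commute)
  then have "wedge_norm p j (\<lambda>k. lift p (c k)) = \<bar>P\<bar>"
    by (simp add: wedge_norm_def comb)
  then have "wedge p j (\<lambda>i. lift p (e i)) =
      (\<lambda>w. sgn P * (wedge p j (\<lambda>k. lift p (c k)) w / wedge_norm p j (\<lambda>k. lift p (c k))))"
    using P0 by (intro ext) (simp add: comb sgn_real_def)
  moreover have "sgn P \<in> {1, -1}" using P0 by (simp add: sgn_real_def)
  ultimately show "\<exists>\<epsilon>\<in>{1, -1}. wedge p j (\<lambda>i. lift p (e i)) =
      (\<lambda>w. \<epsilon> * (wedge p j (\<lambda>k. lift p (c k)) w / wedge_norm p j (\<lambda>k. lift p (c k))))"
    by blast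
qed

text \<open>
  Row \<open>j\<close> is read off by evaluating both sides on \<open>e\<^sub>1, \<dots>, e\<^bsub>j-1\<^esub>, u\<close> with \<open>u\<close> orthogonal to
  \<open>e\<^sub>1, \<dots>, e\<^bsub>j-1\<^esub>\<close>: by the earlier rows both determinants are triangular, so
  \<open>\<langle>c\<^sub>j, u\<rangle>\<close> is a nonzero multiple of \<open>\<langle>e\<^sub>j, u\<rangle>\<close>.
\<close>

lemma triangular_of_wedge:
  fixes e :: "nat \<Rightarrow> complex^'n::finite"
  assumes e: "unitary_frame e"
    and w: "\<And>j. j \<in> {1..CARD('n)} \<Longrightarrow> \<exists>\<epsilon>\<in>{1, -1}. wedge p j (\<lambda>i. lift p (e i)) =
      (\<lambda>w. \<epsilon> * (wedge p j (\<lambda>k. lift p (c k)) w / wedge_norm p j (\<lambda>k. lift p (c k))))"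
  shows "triangular c e"
proof -
  let ?n = "CARD('n)"
  have "(\<forall>i\<in>{1..?n}. Im (hprod (c j) (e i)) = 0 \<and> (j < i \<longrightarrow> hprod (c j) (e i) = 0)) \<and>
     hprod (c j) (e j) \<noteq> 0" if "j \<in> {1..?n}" for j
    using that
  proof (induction j rule: less_induct)
    case (less j)
    have IH: "Im (hprod (c k) (e i)) = 0" "k < i \<Longrightarrow> hprod (c k) (e i) = 0" "hprod (c k) (e k) \<noteq> 0"
      if "k \<in> {1..<j}" "i \<in> {1..?n}" for k i
      using less.IH[of k] less.prems that by auto
    obtain \<epsilon> where \<epsilon>: "\<epsilon> \<in> {1, -1}" "\<And>w. wedge p j (\<lambda>i. lift p (e i)) w =
        \<epsilon> * (wedge p j (\<lambda>k. lift p (c k)) w / wedge_norm p j (\<lambda>k. lift p (c k)))"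
      using w[OF less.prems] by metis
    define N where "N = wedge_norm p j (\<lambda>k. lift p (c k))"
    define P where "P = (\<Prod>i\<in>{1..<j}. c i \<bullet> e i)"
    have split: "{1..j} = insert j {1..<j}" using less.prems by auto
    have "c k \<bullet> e k \<noteq> 0" if "k \<in> {1..<j}" for k
      using IH[OF that, of k] that less.prems by (simp add: complex_eq_iff Re_hprod)
    then have P0: "P \<noteq> 0" by (simp add: P_def)
    have key: "e j \<bullet> u = \<epsilon> * (P * (c j \<bullet> u) / N)" if u: "\<And>k. k \<in> {1..<j} \<Longrightarrow> e k \<bullet> u = 0" for u
    proof -
      let ?w = "\<lambda>k. lift p (if k < j then e k else u)"
      have e_low: "e i \<bullet> (if k < j then e k else u) = 0" if "i \<in> {1..j}" "k \<in> {1..j}" "i < k" for i k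
        using unitary_frame_inner(1)[OF e, of i k] u[of i] that less.prems by auto
      have c_low: "c i \<bullet> (if k < j then e k else u) = 0" if ik: "i \<in> {1..j}" "k \<in> {1..j}" "i < k" for i k
      proof (cases "k < j")
        case True
        then show ?thesis using IH(2)[of i k] ik less.prems by (simp flip: Re_hprod)
      next
        case False
        have i: "i \<in> {1..<j}" "i \<in> {1..?n}" using ik less.prems by auto
        have "c i = (\<Sum>l=1..i. (c i \<bullet> e l) *\<^sub>R e l)"
          using i IH by (intro triangular_row[OF e]) auto
        then have "c i \<bullet> u = (\<Sum>l=1..i. (c i \<bullet> e l) * (e l \<bullet> u))"
          by (metis (no_types, lifting) inner_scaleR_left inner_sum_left sum.cong)
        also have "\<dots> = 0" using i u by (intro sum.neutral) auto
        finally show ?thesis using False by simp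
      qed
      have "wedge p j (\<lambda>i. lift p (e i)) ?w = (\<Prod>i=1..j. e i \<bullet> (if i < j then e i else u))"
        by (subst wedge_lower_triangular) (simp_all only: levi_lift_right cpx_lift e_low)
      also have "\<dots> = (e j \<bullet> u) * (\<Prod>i\<in>{1..<j}. e i \<bullet> (if i < j then e i else u))"
        by (simp add: split)
      also have "(\<Prod>i\<in>{1..<j}. e i \<bullet> (if i < j then e i else u)) = 1"
        using less.prems by (intro prod.neutral) (simp add: unitary_frame_inner(1)[OF e])
      finally have 1: "wedge p j (\<lambda>i. lift p (e i)) ?w = e j \<bullet> u" by simp
      have "wedge p j (\<lambda>i. lift p (c i)) ?w = (\<Prod>i=1..j. c i \<bullet> (if i < j then e i else u))"
        by (subst wedge_lower_triangular) (simp_all only: levi_lift_right cpx_lift c_low)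
      also have "\<dots> = (c j \<bullet> u) * P"
        unfolding split P_def by (simp cong: prod.cong_simp)
      finally show ?thesis using 1 \<epsilon>(2)[of ?w] by (simp add: N_def mult.commute)
    qed
    have ej: "e k \<bullet> e i = 0" if "k \<in> {1..<j}" "i \<in> {j..?n}" for k i
      using unitary_frame_inner(1)[OF e, of k i] that by auto
    have jj: "e j \<bullet> e j = 1" using unitary_frame_inner(1)[OF e less.prems less.prems] by simp
    have "e j \<bullet> e j = \<epsilon> * (P * (c j \<bullet> e j) / N)"
      by (rule key, rule ej) (use less.prems in auto)
    then have "1 = \<epsilon> * (P * (c j \<bullet> e j) / N)" unfolding jj .
    then have N0: "N \<noteq> 0" and cj: "c j \<bullet> e j \<noteq> 0" by auto
    have zero: "c j \<bullet> u = 0" if "\<And>k. k \<in> {1..j} \<Longrightarrow> e k \<bullet> u = 0" for u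
      using key[of u] that[of j] that \<epsilon>(1) P0 N0 less.prems by auto
    have "Im (hprod (c j) (e i)) = 0" if i: "i \<in> {1..?n}" for i
      unfolding Im_hprod using unitary_frame_inner(2)[OF e _ i] less.prems by (intro zero) auto
    moreover have "Re (hprod (c j) (e i)) = 0" if i: "i \<in> {1..?n}" "j < i" for i
      unfolding Re_hprod using unitary_frame_inner(1)[OF e _ i(1)] less.prems i by (intro zero) auto
    ultimately show ?case using cj by (auto simp: complex_eq_iff simp flip: Re_hprod)
  qed
  then show ?thesis unfolding triangular_def by blast
qed

text \<open>
  Real combinations of a unitary frame have real Hermitian products, so their span is isotropic for
  the imaginary part. If it contained \<open>X\<close> and \<open>J X\<close>, then \<open>0 = Im \<langle>J X, X\<rangle> = \<bar>X\<bar>\<^sup>2\<close>.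
\<close>

lemma totally_real_triangular:
  fixes e :: "nat \<Rightarrow> complex^'n::finite"
  assumes T: "triangular c e" and e: "unitary_frame e"
  shows "totally_real p (span ((\<lambda>k. lift p (c k)) ` {1..CARD('n)}))"
proof -
  let ?n = "CARD('n)" and ?P = "span ((\<lambda>k. lift p (c k)) ` {1..CARD('n)})"
  have cc: "Im (hprod (c k) (c l)) = 0" if k: "k \<in> {1..?n}" and l: "l \<in> {1..?n}" for k l
  proof -
    have real: "Im (hprod (e i) (e m)) = 0" if "i \<in> {1..k}" "m \<in> {1..l}" for i m
      using e that k l by (simp add: unitary_frame_def)
    have "Im (hprod (\<Sum>i=1..k. (c k \<bullet> e i) *\<^sub>R e i) (\<Sum>m=1..l. (c l \<bullet> e m) *\<^sub>R e m)) = 0"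
      unfolding hprod_sum hprod_linear Im_sum by (intro sum.neutral ballI) (simp add: real Im_sum hprod_linear)
    then show ?thesis
      using triangular_combination(1)[OF T e k] triangular_combination(1)[OF T e l] by simp
  qed
  have sub: "subspace {X. Im (hprod (cpx X) v) = 0}" "subspace {X. Im (hprod v (cpx X)) = 0}" for v
    by (auto simp: subspace_def cpx_linear hprod_linear)
  have 1: "Im (hprod (cpx X) (c l)) = 0" if "X \<in> ?P" "l \<in> {1..?n}" for X l
  proof -
    have "?P \<subseteq> {X. Im (hprod (cpx X) (c l)) = 0}"
      using cc that(2) by (intro span_minimal sub) auto
    then show ?thesis using that(1) by blast
  qed
  have isotropic: "Im (hprod (cpx Y) (cpx X)) = 0" if "X \<in> ?P" "Y \<in> ?P" for X Y
  proof -
    have "?P \<subseteq> {X. Im (hprod (cpx Y) (cpx X)) = 0}"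
      using 1[OF that(2)] by (intro span_minimal sub) auto
    then show ?thesis using that(1) by blast
  qed
  have contact: "?P \<subseteq> contact p"
    unfolding contact_def
    by (intro span_minimal subspace_span) (auto simp: contact_eq_range_lift simp flip: contact_def)
  show ?thesis unfolding totally_real_def
  proof (intro conjI ballI impI contact subspace_span)
    fix X assume X: "X \<in> ?P" "X \<noteq> 0"
    show "J p X \<notin> ?P"
    proof
      assume JX: "J p X \<in> ?P"
      have "Im (\<i> * hprod (cpx X) (cpx X)) = 0"
        using isotropic[OF X(1) JX] by (simp add: J_lift hprod_linear)
      then have "cpx X = 0" by (simp add: hprod_self)
      moreover obtain v where "X = lift p v" using X(1) contact by (auto simp: contact_eq_range_lift)
      ultimately show False using X(2) by simp
    qed
  qed
qed

section \<open>The Frenet equations\<close>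

lemma hprod_moving_derivative:
  assumes "(c has_vector_derivative c') (at s)"
    "(e has_vector_derivative (\<Sum>l\<in>F. A l *s f l)) (at s)"
  shows "((\<lambda>s. hprod (c s) (e s)) has_vector_derivative
    (\<Sum>l\<in>F. cnj (A l) * hprod (c s) (f l)) + hprod c' (e s)) (at s)"
  using hprod_vector_derivative[OF assms] by (simp add: hprod_sum hprod_linear)

text \<open>
  Used to differentiate the constraints on a frame and on the rows of a triangular family: that a
  coefficient vanishes, or that it is real.
\<close>

lemma vector_derivative_in_kernel:
  assumes "open I" "s \<in> I" "(q has_vector_derivative q') (at s)" "bounded_linear h"
    and "\<And>t. t \<in> I \<Longrightarrow> h (q t) = 0"
  shows "h q' = 0"
proof -
  have "((\<lambda>t. h (q t)) has_vector_derivative h q') (at s)"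
    by (rule bounded_linear.has_vector_derivative[OF assms(4,3)])
  then have "((\<lambda>t. 0) has_vector_derivative h q') (at s)"
    by (rule has_vector_derivative_transform_within_open[OF _ assms(1,2)]) (simp add: assms(5))
  then show ?thesis by (rule vector_derivative_unique_at) (rule has_vector_derivative_const)
qed

text \<open>
  Differentiating \<open>\<langle>c\<^sub>k, e\<^sub>i\<rangle>\<close> gives
  \<open>\<langle>c\<^bsub>k+1\<^esub>, e\<^sub>i\<rangle> = \<langle>c\<^sub>k, e\<^sub>i\<rangle>' - \<Sum>\<^sub>l cnj (A\<^bsub>il\<^esub>) \<langle>c\<^sub>k, e\<^sub>l\<rangle>\<close>. Since the Frenet matrix \<open>A\<close> is tridiagonal
  and real outside its last diagonal entry, which meets only \<open>\<langle>c\<^sub>k, e\<^sub>n\<rangle> = 0\<close>, the shape of row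
  \<open>k\<close> passes to row \<open>k + 1\<close>, and the new diagonal entry is \<open>\<kappa>\<^sub>k\<close> times the old one.
\<close>

lemma triangular_of_frenet:
  fixes e c :: "nat \<Rightarrow> real \<Rightarrow> complex^'n::finite"
  assumes I: "open I"
    and de: "\<And>j s. j \<in> {1..CARD('n)} \<Longrightarrow> s \<in> I \<Longrightarrow> (e j has_vector_derivative
      (\<Sum>k=1..CARD('n). frenet_matrix CARD('n) (\<lambda>i. \<kappa> i s) j k *s e k s)) (at s)"
    and e: "\<And>s. s \<in> I \<Longrightarrow> unitary_frame (\<lambda>j. e j s)"
    and dc: "\<And>k s. s \<in> I \<Longrightarrow> (c k has_vector_derivative c (Suc k) s) (at s)"
    and c1: "\<And>s. s \<in> I \<Longrightarrow> c 1 s = e 1 s"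
    and \<kappa>: "\<And>j s. j \<in> {1..<CARD('n)} \<Longrightarrow> s \<in> I \<Longrightarrow> \<kappa> j s \<noteq> 0"
    and s: "s \<in> I"
  shows "triangular (\<lambda>k. c k s) (\<lambda>j. e j s)"
proof -
  let ?n = "CARD('n)"
  have "1 \<le> k \<Longrightarrow> k \<le> ?n \<Longrightarrow> \<forall>s\<in>I. (\<forall>i\<in>{1..?n}. Im (hprod (c k s) (e i s)) = 0 \<and>
      (k < i \<longrightarrow> hprod (c k s) (e i s) = 0)) \<and> hprod (c k s) (e k s) \<noteq> 0" for k
  proof (induction k rule: nat_induct_at_least)
    case base
    have "1 \<in> {1..?n}" by (simp add: Suc_le_eq One_nat_def)
    then have "hprod (e 1 s) (e i s) = (if 1 = i then 1 else 0)" if "i \<in> {1..?n}" "s \<in> I" for i s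
      using e[OF that(2)] that(1) unfolding unitary_frame_def by blast
    then show ?case using c1 \<open>1 \<in> {1..?n}\<close> by simp
  next
    case (Suc k)
    then have k: "1 \<le> k" "k < ?n" by auto
    have IH: "Im (hprod (c k s) (e i s)) = 0" "k < i \<Longrightarrow> hprod (c k s) (e i s) = 0"
      "hprod (c k s) (e k s) \<noteq> 0" if "i \<in> {1..?n}" "s \<in> I" for i s
      using Suc.IH k that by auto
    show ?case
    proof
      fix s assume s: "s \<in> I"
      let ?A = "frenet_matrix ?n (\<lambda>i. \<kappa> i s)"
      let ?S = "\<lambda>i. \<Sum>l=1..?n. cnj (?A i l) * hprod (c k s) (e l s)"
      have d: "((\<lambda>s. hprod (c k s) (e i s)) has_vector_derivative
          ?S i + hprod (c (Suc k) s) (e i s)) (at s)" if "i \<in> {1..?n}" for i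
        by (rule hprod_moving_derivative[OF dc[OF s] de[OF that s]])
      have "Im (hprod (c (Suc k) s) (e i s)) = 0" if i: "i \<in> {1..?n}" for i
      proof -
        have "Im (?S i + hprod (c (Suc k) s) (e i s)) = 0"
          by (rule vector_derivative_in_kernel[OF I s d[OF i] bounded_linear_Im]) (rule IH(1)[OF i])
        moreover have "Im (cnj (?A i l) * hprod (c k s) (e l s)) = 0" if l: "l \<in> {1..?n}" for l
          using IH(1,2)[OF l s] k by (auto simp: frenet_matrix_def)
        ultimately show ?thesis by (simp add: Im_sum)
      qed
      moreover have shift: "hprod (c (Suc k) s) (e i s) = - ?S i" if i: "i \<in> {1..?n}" "k < i" for i
      proof -
        have "?S i + hprod (c (Suc k) s) (e i s) = 0"
          by (rule vector_derivative_in_kernel[OF I s d[OF i(1)] bounded_linear_ident])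
            (rule IH(2)[OF i(1) _ i(2)])
        then show ?thesis by (simp add: eq_neg_iff_add_eq_0 add.commute)
      qed
      moreover have "?S i = 0" if i: "i \<in> {1..?n}" "Suc k < i" for i
      proof (intro sum.neutral ballI)
        fix l assume l: "l \<in> {1..?n}"
        show "cnj (?A i l) * hprod (c k s) (e l s) = 0"
        proof (cases "k < l")
          case True
          then show ?thesis using IH(2)[OF l s] by simp
        next
          case False
          then show ?thesis using i by (simp add: frenet_matrix_def)
        qed
      qed
      moreover have "hprod (c (Suc k) s) (e (Suc k) s) \<noteq> 0"
      proof -
        have "?S (Suc k) = (\<Sum>l\<in>{k}. cnj (?A (Suc k) l) * hprod (c k s) (e l s))"
        proof (rule sum.mono_neutral_right)
          show "\<forall>l\<in>{1..?n} - {k}. cnj (?A (Suc k) l) * hprod (c k s) (e l s) = 0"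
          proof
            fix l assume l: "l \<in> {1..?n} - {k}"
            show "cnj (?A (Suc k) l) * hprod (c k s) (e l s) = 0"
            proof (cases "k < l")
              case True
              then show ?thesis using IH(2)[of l, OF _ s] l by simp
            next
              case False
              then show ?thesis using l by (simp add: frenet_matrix_def)
            qed
          qed
        qed (use k in auto)
        also have "\<dots> = - of_real (\<kappa> k s) * hprod (c k s) (e k s)"
          by (simp add: frenet_matrix_def)
        finally show ?thesis
          using shift[of "Suc k"] IH(3)[of k, OF _ s] \<kappa>[of k, OF _ s] k by simp
      qed
      ultimately show "(\<forall>i\<in>{1..?n}. Im (hprod (c (Suc k) s) (e i s)) = 0 \<and>
          (Suc k < i \<longrightarrow> hprod (c (Suc k) s) (e i s) = 0)) \<and> hprod (c (Suc k) s) (e (Suc k) s) \<noteq> 0"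
        by simp
    qed
  qed
  then show ?thesis using s unfolding triangular_def by auto
qed

text \<open>
  The same identity read in the opposite direction: as row \<open>j\<close> is real and ends at \<open>e\<^sub>j\<close>, and
  row \<open>j + 1\<close> at \<open>e\<^bsub>j+1\<^esub>\<close>, the derivative of \<open>e\<^sub>j\<close> has real coefficients and ends at \<open>e\<^bsub>j+1\<^esub>\<close>
  as long as \<open>j < n\<close>. Together with the skew symmetry of a moving unitary frame only the
  p-curvatures remain.
\<close>

lemma frenet_of_triangular:
  fixes e c :: "nat \<Rightarrow> real \<Rightarrow> complex^'n::finite"
  assumes I: "open I"
    and de: "\<And>j s. j \<in> {1..CARD('n)} \<Longrightarrow> s \<in> I \<Longrightarrow> (e j has_vector_derivative e' j s) (at s)"
    and e: "\<And>s. s \<in> I \<Longrightarrow> unitary_frame (\<lambda>j. e j s)"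
    and dc: "\<And>k s. s \<in> I \<Longrightarrow> (c k has_vector_derivative c (Suc k) s) (at s)"
    and T: "\<And>s. s \<in> I \<Longrightarrow> triangular (\<lambda>k. c k s) (\<lambda>j. e j s)"
    and \<kappa>: "\<And>j s. j \<in> {1..<CARD('n)} \<Longrightarrow> s \<in> I \<Longrightarrow> \<kappa> j s = e' j s \<bullet> e (j + 1) s"
      "\<And>s. s \<in> I \<Longrightarrow> \<kappa> CARD('n) s = e' CARD('n) s \<bullet> (\<i> *s e CARD('n) s)"
    and j: "j \<in> {1..CARD('n)}" and s: "s \<in> I"
  shows "(e j has_vector_derivative
    (\<Sum>k=1..CARD('n). frenet_matrix CARD('n) (\<lambda>i. \<kappa> i s) j k *s e k s)) (at s)"
proof -
  let ?n = "CARD('n)"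
  define B where "B j m = hprod (e' j s) (e m s)" for j m
  have row: "Im (hprod (c k t) (e i t)) = 0" "k < i \<Longrightarrow> hprod (c k t) (e i t) = 0"
    if "k \<in> {1..?n}" "i \<in> {1..?n}" "t \<in> I" for k i t
    using T[OF that(3)] that(1,2) unfolding triangular_def by blast+
  have skew: "B j m = - cnj (B m j)" if j: "j \<in> {1..?n}" and m: "m \<in> {1..?n}" for j m
  proof -
    have d: "((\<lambda>t. hprod (e j t) (e m t) - (if j = m then 1 else 0)) has_vector_derivative
        hprod (e j s) (e' m s) + hprod (e' j s) (e m s) - 0) (at s)"
      by (intro has_vector_derivative_diff hprod_vector_derivative de j m s has_vector_derivative_const)
    have "hprod (e j s) (e' m s) + hprod (e' j s) (e m s) - 0 = 0"
      by (rule vector_derivative_in_kernel[OF I s d bounded_linear_ident])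
        (use e j m in \<open>simp add: unitary_frame_def\<close>)
    then show ?thesis
      using hprod_commute[of "e j s" "e' m s"] by (simp add: B_def eq_neg_iff_add_eq_0 add.commute)
  qed
  have low: "j < ?n \<longrightarrow> (\<forall>m\<in>{1..?n}. Im (B j m) = 0 \<and> (j + 1 < m \<longrightarrow> B j m = 0))"
    if "j \<in> {1..?n}" for j
    using that
  proof (induction j rule: less_induct)
    case (less j)
    show ?case
    proof (intro impI ballI)
      fix m assume jn: "j < ?n" and m: "m \<in> {1..?n}"
      have IH: "Im (B l m) = 0" "j + 1 < m \<Longrightarrow> B l m = 0" if "l \<in> {1..<j}" for l
        using less.IH[of l] that jn m less.prems by auto
      have jj: "{1..j} = insert j {1..<j}" using less.prems by auto
      define t where "t l = c j s \<bullet> e l s" for l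
      have t: "t j \<noteq> 0" "c j s = (\<Sum>l=1..j. t l *\<^sub>R e l s)"
        unfolding t_def using triangular_combination[OF T[OF s] e[OF s] less.prems] by blast+
      have d: "((\<lambda>u. hprod (c j u) (e m u)) has_vector_derivative
          hprod (c j s) (e' m s) + hprod (c (Suc j) s) (e m s)) (at s)"
        by (rule hprod_vector_derivative[OF dc[OF s] de[OF m s]])
      have "hprod (c j s) (e' m s) = (\<Sum>l=1..j. t l *\<^sub>R hprod (e l s) (e' m s))"
        by (subst t(2)) (simp add: hprod_sum hprod_linear)
      also have "\<dots> = (\<Sum>l=1..j. - (t l *\<^sub>R B l m))"
      proof (intro sum.cong refl)
        fix l assume "l \<in> {1..j}"
        then have "B l m = - cnj (B m l)" using skew[of l m] m jn by auto
        then show "t l *\<^sub>R hprod (e l s) (e' m s) = - (t l *\<^sub>R B l m)"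
          using hprod_commute[of "e l s" "e' m s"] by (simp add: B_def)
      qed
      finally have sum: "hprod (c j s) (e' m s) = - (t j *\<^sub>R B j m) - (\<Sum>l\<in>{1..<j}. t l *\<^sub>R B l m)"
        unfolding jj by (simp add: sum_negf)
      have "Im (hprod (c j s) (e' m s) + hprod (c (Suc j) s) (e m s)) = 0"
        by (rule vector_derivative_in_kernel[OF I s d bounded_linear_Im]) (rule row(1)[OF less.prems m])
      moreover have "Im (hprod (c (Suc j) s) (e m s)) = 0" using row(1)[of "Suc j" m s] jn m s by simp
      moreover have "Im (\<Sum>l\<in>{1..<j}. t l *\<^sub>R B l m) = 0" using IH(1) by (simp add: Im_sum)
      ultimately have Im0: "Im (B j m) = 0" using t(1) by (simp add: sum)
      have "B j m = 0" if jm: "j + 1 < m"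
      proof -
        have "hprod (c j s) (e' m s) + hprod (c (Suc j) s) (e m s) = 0"
          by (rule vector_derivative_in_kernel[OF I s d bounded_linear_ident])
            (rule row(2)[OF less.prems m], use jm in auto)
        moreover have "hprod (c (Suc j) s) (e m s) = 0" using row(2)[of "Suc j" m s] jn m s jm by simp
        moreover have "(\<Sum>l\<in>{1..<j}. t l *\<^sub>R B l m) = 0" using IH(2) jm by simp
        ultimately show ?thesis using t(1) by (simp add: sum)
      qed
      with Im0 show "Im (B j m) = 0 \<and> (j + 1 < m \<longrightarrow> B j m = 0)" by blast
    qed
  qed
  let ?A = "frenet_matrix ?n (\<lambda>i. \<kappa> i s)"
  have upper: "B i m = ?A i m" if i: "i \<in> {1..?n}" and m: "m \<in> {1..?n}" and im: "i < m" for i m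
  proof (cases "m = i + 1")
    case True
    have "Re (B i m) = \<kappa> i s" using \<kappa>(1)[of i s] i m im s True by (simp add: B_def Re_hprod)
    then show ?thesis using low[OF i] m im True by (simp add: frenet_matrix_def complex_eq_iff)
  next
    case False
    then show ?thesis using low[OF i] m im by (simp add: frenet_matrix_def)
  qed
  have BA: "B j m = ?A j m" if m: "m \<in> {1..?n}" for m
  proof (rule linorder_cases[of j m])
    assume "j < m" then show ?thesis using upper[OF j m] by blast
  next
    assume "m < j" then show ?thesis
      using upper[OF m j] skew[OF j m] frenet_matrix_antihermitian[of ?n _ j m] by simp
  next
    assume jm: "j = m"
    have Re0: "Re (B j j) = 0" using arg_cong[OF skew[OF j j], of Re] by simp
    show ?thesis
    proof (cases "j = ?n")
      case True
      then have "Im (B j j) = \<kappa> ?n s" using \<kappa>(2)[OF s] by (simp add: B_def Im_hprod)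
      then show ?thesis using Re0 jm True by (simp add: frenet_matrix_def complex_eq_iff)
    next
      case False
      then show ?thesis using low[OF j] j Re0 jm by (simp add: frenet_matrix_def complex_eq_iff)
    qed
  qed
  have "e' j s = (\<Sum>k=1..?n. B j k *s e k s)"
    unfolding B_def by (rule unitary_frame_expansion[OF e[OF s], symmetric])
  also have "\<dots> = (\<Sum>k=1..?n. ?A j k *s e k s)" using BA by (intro sum.cong) auto
  finally show ?thesis using de[OF j s] by simp
qed

section \<open>Derivatives of a curve\<close>

lemma curve_deriv_Suc: "curve_deriv (Suc k) \<gamma> t = vector_derivative (curve_deriv k \<gamma>) (at t)"
  by (simp add: curve_deriv_def)

lemma curve_deriv_has_vector_derivative:
  assumes "open I" "smooth_on I \<gamma>" "s \<in> I"
  shows "(curve_deriv k \<gamma> has_vector_derivative curve_deriv (Suc k) \<gamma> s) (at s)"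
proof -
  have "smooth_on I (curve_deriv k \<gamma>)" for k
  proof (induction k)
    case 0
    then show ?case using assms(2) by (simp add: curve_deriv_def)
  next
    case (Suc k)
    then show ?case using smooth_on_vector_derivative(2)[OF assms(1) Suc]
      by (simp add: curve_deriv_Suc[abs_def])
  qed
  then show ?thesis
    unfolding curve_deriv_Suc by (rule smooth_on_vector_derivative(1)[OF assms(1) _ assms(3)])
qed

lemma contact_deriv_lift: "contact_deriv k \<gamma> s = lift (\<gamma> s) (cpx (curve_deriv k \<gamma> s))"
  by (simp add: contact_deriv_def contact_part_lift)

lemma cpx_curve_deriv:
  assumes "open I" "smooth_on I \<gamma>" "s \<in> I"
  shows "((\<lambda>s. cpx (curve_deriv k \<gamma> s)) has_vector_derivative cpx (curve_deriv (Suc k) \<gamma> s)) (at s)"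
  by (rule bounded_linear.has_vector_derivative[OF bounded_linear_cpx
        curve_deriv_has_vector_derivative[OF assms]])

section \<open>Existence of a curve with given p-curvatures\<close>

lemma unitary_frame_exists: "\<exists>e :: nat \<Rightarrow> complex^'n::finite. unitary_frame e"
proof -
  obtain h where h: "bij_betw h {1..CARD('n)} (UNIV :: 'n set)"
    using ex_bij_betw_nat_finite_1[of "UNIV :: 'n set"] by auto
  have "hprod (axis a 1) (axis b 1) = (if a = b then 1 else 0)" for a b :: 'n
  proof -
    have "(axis a (1::complex)) $ k * cnj ((axis b 1) $ k) =
        (if k = a then if a = b then 1 else 0 else 0)" for k
      by (simp add: axis_def)
    then show ?thesis by (simp add: hprod_def)
  qed
  moreover have "h j = h k \<longleftrightarrow> j = k" if "j \<in> {1..CARD('n)}" "k \<in> {1..CARD('n)}" for j k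
    using h that by (auto simp: bij_betw_def inj_on_eq_iff)
  ultimately have "unitary_frame (\<lambda>j. axis (h j) 1)" by (simp add: unitary_frame_def)
  then show ?thesis by blast
qed

text \<open>
  Unitary initial data stay unitary: the matrix \<open>M\<^sup>* M\<close> is constant, and being the identity it
  makes the rows of the square matrix \<open>M\<close> orthonormal.
\<close>

lemma frenet_frame_exists:
  fixes \<kappa> :: "nat \<Rightarrow> real \<Rightarrow> real"
  assumes I: "open I" "is_interval I" "s\<^sub>0 \<in> I"
    and \<kappa>: "\<And>j. j \<in> {1..CARD('n)} \<Longrightarrow> smooth_on I (\<kappa> j)"
  obtains e :: "nat \<Rightarrow> real \<Rightarrow> complex^'n::finite" where
    "\<And>j s. j \<in> {1..CARD('n)} \<Longrightarrow> s \<in> I \<Longrightarrow> (e j has_vector_derivative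
      (\<Sum>k=1..CARD('n). frenet_matrix CARD('n) (\<lambda>i. \<kappa> i s) j k *s e k s)) (at s)"
    "\<And>s. s \<in> I \<Longrightarrow> unitary_frame (\<lambda>j. e j s)"
    "\<And>j. j \<in> {1..CARD('n)} \<Longrightarrow> smooth_on I (e j)"
proof -
  let ?n = "CARD('n)"
  define A where "A s = frenet_matrix ?n (\<lambda>i. \<kappa> i s)" for s
  have A: "smooth_on I (\<lambda>s. A s j k)" if "j \<in> {1..?n}" "k \<in> {1..?n}" for j k
    unfolding A_def using that by (intro smooth_frenet_matrix \<kappa>)
  have anti: "A s j k = - cnj (A s k j)" for s j k
    unfolding A_def by (rule frenet_matrix_antihermitian)
  obtain e\<^sub>0 :: "nat \<Rightarrow> complex^'n" where e\<^sub>0: "unitary_frame e\<^sub>0" using unitary_frame_exists by blast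
  obtain e where de: "\<And>j s. j \<in> {1..?n} \<Longrightarrow> s \<in> I \<Longrightarrow>
      (e j has_vector_derivative (\<Sum>k=1..?n. A s j k *s e k s)) (at s)"
    and init: "\<And>j. j \<in> {1..?n} \<Longrightarrow> e j s\<^sub>0 = e\<^sub>0 j"
    by (rule moving_frame_exists[where A = A and e\<^sub>0 = e\<^sub>0, OF I smooth_on_continuous[OF A]]) blast+
  obtain K where K: "\<forall>s\<in>I. \<forall>a b. (\<Sum>j=1..?n. cnj (e j s $ a) * e j s $ b) = K a b"
    using moving_frames_product_constant[OF I(2) de de anti] ..
  have "K a b = (if a = b then 1 else 0)" for a b
  proof -
    have "K a b = (\<Sum>j=1..?n. cnj (e j s\<^sub>0 $ a) * e j s\<^sub>0 $ b)" using K I(3) by simp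
    also have "\<dots> = (\<Sum>j=1..?n. cnj (e\<^sub>0 j $ a) * e\<^sub>0 j $ b)"
      by (intro sum.cong) (auto simp: init)
    finally show ?thesis using e\<^sub>0 unfolding unitary_frame_iff_columns by simp
  qed
  then have unit: "unitary_frame (\<lambda>j. e j s)" if "s \<in> I" for s
    using K that by (simp add: unitary_frame_iff_columns)
  have smooth: "smooth_on I (e j)" if "j \<in> {1..?n}" for j
    by (rule moving_frame_smooth[OF de A that])
  show thesis by (rule that[OF de[unfolded A_def] unit smooth])
qed

text \<open>
  Integrating \<open>e\<^sub>1\<close> gives the complex coordinates of the curve, and horizontality then
  prescribes the derivative of the height.
\<close>

lemma horizontal_curve_with_tangent:
  fixes v :: "real \<Rightarrow> complex^'n::finite"
  assumes I: "open I" "is_interval I" "s\<^sub>0 \<in> I" and v: "smooth_on I v"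
  obtains \<gamma> where "smooth_on I \<gamma>" "\<And>s. s \<in> I \<Longrightarrow> (\<gamma> has_vector_derivative lift (\<gamma> s) (v s)) (at s)"
proof -
  obtain x where x: "\<And>s. s \<in> I \<Longrightarrow> (x has_vector_derivative v s) (at s)"
    using antiderivative_on_open_interval[OF I smooth_on_continuous[OF v]] by blast
  have smooth_x: "smooth_on I x" by (rule smooth_on_of_derivative[OF x v])
  have smooth_h: "smooth_on I (\<lambda>s. Im (hprod (x s) (v s)))"
    by (intro smooth_on_linear[OF bounded_linear_Im] smooth_on_bilinear[OF bounded_bilinear_hprod]
        smooth_x v)
  obtain z where z: "\<And>s. s \<in> I \<Longrightarrow> (z has_vector_derivative Im (hprod (x s) (v s))) (at s)"
    using antiderivative_on_open_interval[OF I smooth_on_continuous[OF smooth_h]] by blast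
  have "smooth_on I (\<lambda>s. of_cpx (x s) (z s))"
    by (intro smooth_on_of_cpx smooth_x smooth_on_of_derivative[OF z smooth_h])
  moreover have "((\<lambda>s. of_cpx (x s) (z s)) has_vector_derivative lift (of_cpx (x s) (z s)) (v s)) (at s)"
    if "s \<in> I" for s
    using of_cpx_vector_derivative[OF x[OF that] z[OF that]] by (simp add: lift_def)
  ultimately show thesis using that by blast
qed

text \<open>
  The curve whose tangent is the first leg of the Frenet frame. Nonvanishing of
  \<open>\<kappa>\<^sub>1, \<dots>, \<kappa>\<^bsub>n-1\<^esub>\<close> makes its derivatives triangular with nonzero diagonal, which gives at once
  non-degeneracy and that the lifted Frenet frame is adapted.
\<close>

lemma curve_with_p_curvatures_exists:
  fixes \<kappa> :: "nat \<Rightarrow> real \<Rightarrow> real"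
  assumes I: "open I" "is_interval I" "s\<^sub>0 \<in> I"
    and \<kappa>: "\<And>j. j \<in> {1..CARD('n)} \<Longrightarrow> smooth_on I (\<kappa> j)"
      "\<And>j s. j \<in> {1..<CARD('n)} \<Longrightarrow> s \<in> I \<Longrightarrow> \<kappa> j s \<noteq> 0"
  shows "\<exists>\<gamma> :: real \<Rightarrow> 'n::finite heis.
    horizontal_on I \<gamma> \<and> horizontal_arc_length_on I \<gamma> \<and> has_p_curvatures I \<gamma> \<kappa>"
proof -
  let ?n = "CARD('n)"
  have n: "1 \<in> {1..?n}" "?n \<in> {1..?n}" by (simp_all add: Suc_le_eq One_nat_def)
  obtain e :: "nat \<Rightarrow> real \<Rightarrow> complex^'n" where
    de: "\<And>j s. j \<in> {1..?n} \<Longrightarrow> s \<in> I \<Longrightarrow> (e j has_vector_derivative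
      (\<Sum>k=1..?n. frenet_matrix ?n (\<lambda>i. \<kappa> i s) j k *s e k s)) (at s)"
    and unit: "\<And>s. s \<in> I \<Longrightarrow> unitary_frame (\<lambda>j. e j s)"
    and smooth_e: "\<And>j. j \<in> {1..?n} \<Longrightarrow> smooth_on I (e j)"
    by (rule frenet_frame_exists[where 'n = 'n and \<kappa> = \<kappa>, OF I \<kappa>(1)]) blast+
  obtain \<gamma> where smooth: "smooth_on I \<gamma>"
    and d\<gamma>: "\<And>s. s \<in> I \<Longrightarrow> (\<gamma> has_vector_derivative lift (\<gamma> s) (e 1 s)) (at s)"
    by (rule horizontal_curve_with_tangent[OF I smooth_e[OF n(1)]]) blast
  define c where "c k s = cpx (curve_deriv k \<gamma> s)" for k s
  have dc: "(c k has_vector_derivative c (Suc k) s) (at s)" if "s \<in> I" for k s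
    unfolding c_def by (rule cpx_curve_deriv[OF I(1) smooth that])
  have deriv1: "curve_deriv 1 \<gamma> s = lift (\<gamma> s) (e 1 s)" if "s \<in> I" for s
    using vector_derivative_at[OF d\<gamma>[OF that]] by (simp add: curve_deriv_def One_nat_def)
  then have c1: "c 1 s = e 1 s" if "s \<in> I" for s using that by (simp add: c_def)
  have contact: "contact_deriv k \<gamma> s = lift (\<gamma> s) (c k s)" for k s
    by (simp add: contact_deriv_lift c_def)
  have T: "triangular (\<lambda>k. c k s) (\<lambda>j. e j s)" if "s \<in> I" for s
    by (rule triangular_of_frenet[OF I(1) de unit dc c1 \<kappa>(2) that])
  define E where "E j s = lift (\<gamma> s) (oriented_legs (\<lambda>i. e i s) j)" for j s
  have E: "E j s = lift (\<gamma> s) (e j s)" if "j \<in> {1..?n}" for j s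
    using that by (simp add: E_def oriented_legs_def)
  have horizontal: "horizontal_on I \<gamma>"
    unfolding horizontal_on_def using smooth contact c1 deriv1 by simp
  have arc: "horizontal_arc_length_on I \<gamma>"
    unfolding horizontal_arc_length_on_def
  proof (intro conjI ballI smooth)
    fix s assume s: "s \<in> I"
    then show "levi_norm (\<gamma> s) (contact_deriv 1 \<gamma> s) = 1"
      using unitary_frame_inner(1)[OF unit[OF s] n(1) n(1)]
      by (simp add: levi_norm_def contact c1 levi_lift_right)
  qed
  have nondegenerate: "nondegenerate_on I \<gamma>"
    unfolding nondegenerate_on_def horizontally_regular_on_def contact
  proof (intro conjI ballI smooth)
    fix s assume s: "s \<in> I"
    have "e 1 s \<noteq> 0" using unitary_frame_inner(1)[OF unit[OF s] n(1) n(1)] by auto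
    then show "lift (\<gamma> s) (c 1 s) \<noteq> 0" by (simp add: c1[OF s])
    have "wedge (\<gamma> s) ?n (\<lambda>k. lift (\<gamma> s) (c k s)) (\<lambda>k. lift (\<gamma> s) (e k s)) \<noteq> 0"
      using wedge_triangular_legs(1)[OF T[OF s] unit[OF s] n(2)]
        triangular_combination(2)[OF T[OF s] unit[OF s]] by simp
    then show "wedge (\<gamma> s) ?n (\<lambda>k. lift (\<gamma> s) (c k s)) \<noteq> (\<lambda>_. 0)" by metis
    show "totally_real (\<gamma> s) (span ((\<lambda>k. lift (\<gamma> s) (c k s)) ` {1..?n}))"
      by (rule totally_real_triangular[OF T[OF s] unit[OF s]])
  qed
  have smooth_legs: "smooth_on I (\<lambda>s. oriented_legs (\<lambda>i. e i s) j)" if j: "j \<in> {1..2 * ?n}" for j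
  proof (cases "j \<le> ?n")
    case True
    then show ?thesis using smooth_e[of j] j by (simp add: oriented_legs_def)
  next
    case False
    then have "j - ?n \<in> {1..?n}" using j by auto
    then have "smooth_on I (e (j - ?n))" by (rule smooth_e)
    then have "smooth_on I (\<lambda>s. \<i> *s e (j - ?n) s)"
      by (rule smooth_on_linear[OF bounded_bilinear.bounded_linear_right[OF bounded_bilinear_vector_scalar_mult]])
    then show ?thesis using False by (simp add: oriented_legs_def)
  qed
  have frame: "adapted_frame I \<gamma> E"
    unfolding adapted_frame_def contact
  proof (intro conjI ballI)
    fix j assume "j \<in> {1..2 * ?n}"
    then show "smooth_on I (E j)"
      unfolding E_def[abs_def] lift_def
      by (intro smooth_on_of_cpx smooth_legs smooth_on_linear[OF bounded_linear_Im]
          smooth_on_bilinear[OF bounded_bilinear_hprod] smooth_on_linear[OF bounded_linear_cpx] smooth)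
  next
    fix s assume "s \<in> I"
    then show "oriented_frame (\<gamma> s) (\<lambda>j. E j s)"
      unfolding E_def by (intro oriented_frame_lift unit)
  next
    fix s j assume s: "s \<in> I" and j: "j \<in> {1..?n}"
    have "wedge (\<gamma> s) j (\<lambda>i. E i s) = wedge (\<gamma> s) j (\<lambda>i. lift (\<gamma> s) (e i s))"
      using j by (intro wedge_cong E) auto
    then show "\<exists>\<epsilon>\<in>{1, -1}. wedge (\<gamma> s) j (\<lambda>i. E i s) =
        (\<lambda>w. \<epsilon> * (wedge (\<gamma> s) j (\<lambda>k. lift (\<gamma> s) (c k s)) w /
          wedge_norm (\<gamma> s) j (\<lambda>k. lift (\<gamma> s) (c k s))))"
      using wedge_triangular_legs(2)[OF T[OF s] unit[OF s] j, of "\<gamma> s"] by simp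
  qed
  have dE: "cpx (vector_derivative (E j) (at s)) =
      (\<Sum>k=1..?n. frenet_matrix ?n (\<lambda>i. \<kappa> i s) j k *s e k s)" if s: "s \<in> I" and j: "j \<in> {1..?n}" for j s
  proof -
    have "smooth_on I (E j)" using frame j unfolding adapted_frame_def by auto
    then have "((\<lambda>s. cpx (E j s)) has_vector_derivative cpx (vector_derivative (E j) (at s))) (at s)"
      by (intro bounded_linear.has_vector_derivative[OF bounded_linear_cpx]
          smooth_on_vector_derivative(1)[OF I(1) _ s])
    then have "(e j has_vector_derivative cpx (vector_derivative (E j) (at s))) (at s)"
      using E[OF j] by simp
    then show ?thesis using de[OF j s] vector_derivative_unique_at by blast
  qed
  have hE: "hprod (cpx (vector_derivative (E j) (at s))) (e m s) = frenet_matrix ?n (\<lambda>i. \<kappa> i s) j m"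
    if s: "s \<in> I" and j: "j \<in> {1..?n}" and m: "m \<in> {1..?n}" for j m s
  proof -
    have "hprod (cpx (vector_derivative (E j) (at s))) (e m s) =
        (\<Sum>k=1..?n. frenet_matrix ?n (\<lambda>i. \<kappa> i s) j k * (if k = m then 1 else 0))"
      unfolding dE[OF s j] hprod_sum hprod_linear
      using unit[OF s] m by (intro sum.cong) (auto simp: unitary_frame_def)
    then show ?thesis using m by (simp add: if_distrib[of "(*) _"] cong: if_cong)
  qed
  have "\<kappa> j s = levi (\<gamma> s) (vector_derivative (E j) (at s)) (E (j + 1) s)"
    if "s \<in> I" "j \<in> {1..<?n}" for j s
    using hE[of s j "j + 1"] that
    by (simp add: E levi_lift_right frenet_matrix_def flip: Re_hprod)
  moreover have "\<kappa> ?n s = levi (\<gamma> s) (vector_derivative (E ?n) (at s)) (E (2 * ?n) s)"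
    if "s \<in> I" for s
  proof -
    have "E (2 * ?n) s = lift (\<gamma> s) (\<i> *s e ?n s)" by (simp add: E_def oriented_legs_def)
    then show ?thesis
      using hE[OF that n(2) n(2)] by (simp add: levi_lift_right frenet_matrix_def flip: Im_hprod)
  qed
  ultimately have "has_p_curvatures I \<gamma> \<kappa>"
    unfolding has_p_curvatures_def using nondegenerate arc frame by blast
  with horizontal arc show ?thesis by blast
qed

section \<open>Uniqueness up to rigid motions\<close>

lemma unitary_frame_coefficient:
  fixes g :: "nat \<Rightarrow> complex^'n::finite"
  assumes "unitary_frame g" "k \<in> {1..CARD('n)}"
  shows "hprod (\<Sum>j=1..CARD('n). a j *s g j) (g k) = a k"
proof -
  have "hprod (\<Sum>j=1..CARD('n). a j *s g j) (g k) = (\<Sum>j=1..CARD('n). a j * (if j = k then 1 else 0))"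
    unfolding hprod_sum hprod_linear using assms
    by (intro sum.cong) (auto simp: unitary_frame_def)
  then show ?thesis using assms(2) by (simp add: if_distrib[of "(*) _"] cong: if_cong)
qed

text \<open>The complex linear map taking each leg of a unitary frame \<open>f\<close> to that of \<open>g\<close>.\<close>

definition frame_change ::
  "(nat \<Rightarrow> complex^'n::finite) \<Rightarrow> (nat \<Rightarrow> complex^'n) \<Rightarrow> complex^'n \<Rightarrow> complex^'n" where
  "frame_change f g v = (\<Sum>j=1..CARD('n). hprod v (f j) *s g j)"

lemma linear_frame_change: "linear (frame_change f g)"
  by (simp add: linear_iff frame_change_def hprod_linear vec_eq_iff sum.distrib algebra_simps
      scaleR_sum_right)

lemma frame_change_scale: "frame_change f g (c *s v) = c *s frame_change f g v"
  by (simp add: frame_change_def hprod_linear vec_eq_iff sum_distrib_left algebra_simps)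

lemma frame_change_leg:
  fixes f g :: "nat \<Rightarrow> complex^'n::finite"
  assumes "unitary_frame f" "k \<in> {1..CARD('n)}"
  shows "frame_change f g (f k) = g k"
proof -
  have "frame_change f g (f k) = (\<Sum>j=1..CARD('n). if j = k then g j else 0)"
    unfolding frame_change_def using assms
    by (intro sum.cong) (auto simp: unitary_frame_def vec_eq_iff)
  then show ?thesis using assms(2) by simp
qed

lemma hprod_frame_change_leg:
  fixes f g :: "nat \<Rightarrow> complex^'n::finite"
  assumes "unitary_frame g" "k \<in> {1..CARD('n)}"
  shows "hprod (frame_change f g v) (g k) = hprod v (f k)"
  unfolding frame_change_def by (rule unitary_frame_coefficient[OF assms])

lemma frame_change_isometry:
  fixes f g :: "nat \<Rightarrow> complex^'n::finite"
  assumes f: "unitary_frame f" and g: "unitary_frame g"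
  shows "hprod (frame_change f g u) (frame_change f g v) = hprod u v"
proof -
  have "hprod (frame_change f g u) (frame_change f g v) =
      (\<Sum>k=1..CARD('n). cnj (hprod v (f k)) * hprod (frame_change f g u) (g k))"
    by (subst (2) frame_change_def) (simp add: hprod_sum hprod_linear)
  also have "\<dots> = (\<Sum>k=1..CARD('n). cnj (hprod v (f k)) * hprod u (f k))"
    by (intro sum.cong refl) (simp add: hprod_frame_change_leg[OF g])
  also have "\<dots> = hprod u (\<Sum>k=1..CARD('n). hprod v (f k) *s f k)"
    by (simp add: hprod_sum hprod_linear)
  finally show ?thesis by (simp add: unitary_frame_expansion[OF f])
qed

lemma frame_change_inverse:
  fixes f g :: "nat \<Rightarrow> complex^'n::finite"
  assumes f: "unitary_frame f" and g: "unitary_frame g"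
  shows "frame_change g f (frame_change f g v) = v"
proof -
  have "frame_change g f (frame_change f g v) = (\<Sum>k=1..CARD('n). hprod v (f k) *s f k)"
    unfolding frame_change_def[of g f]
    by (intro sum.cong refl) (simp add: hprod_frame_change_leg[OF g])
  then show ?thesis by (simp add: unitary_frame_expansion[OF f])
qed

text \<open>
  The adapted frame of the curve, in complex coordinates, solves the Frenet equations. The factor
  \<open>\<tau>\<close> between \<open>e\<^sub>1\<close> and the unit tangent is \<open>1\<close> or \<open>-1\<close> at each point, as the definition of
  an adapted frame leaves signs open, and constant because it is continuous.
\<close>

lemma frenet_frame_of_curve:
  fixes \<gamma> :: "real \<Rightarrow> 'n::finite heis"
  assumes I: "open I" "is_interval I"
    and \<gamma>: "horizontal_on I \<gamma>" "horizontal_arc_length_on I \<gamma>" "has_p_curvatures I \<gamma> \<kappa>"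
  obtains e and \<tau> :: real where
    "\<And>j s. j \<in> {1..CARD('n)} \<Longrightarrow> s \<in> I \<Longrightarrow> (e j has_vector_derivative
      (\<Sum>k=1..CARD('n). frenet_matrix CARD('n) (\<lambda>i. \<kappa> i s) j k *s e k s)) (at s)"
    "\<And>s. s \<in> I \<Longrightarrow> unitary_frame (\<lambda>j. e j s)" "\<bar>\<tau>\<bar> = 1"
    "\<And>s. s \<in> I \<Longrightarrow> (\<gamma> has_vector_derivative lift (\<gamma> s) (\<tau> *\<^sub>R e 1 s)) (at s)"
proof -
  let ?n = "CARD('n)"
  have n: "1 \<in> {1..?n}" by (simp add: Suc_le_eq One_nat_def)
  have smooth: "smooth_on I \<gamma>" using \<gamma>(1) unfolding horizontal_on_def by blast
  obtain E where frame: "adapted_frame I \<gamma> E" and \<kappa>: "\<And>s. s \<in> I \<Longrightarrow>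
      (\<forall>j\<in>{1..<?n}. \<kappa> j s = levi (\<gamma> s) (vector_derivative (E j) (at s)) (E (j + 1) s)) \<and>
      \<kappa> ?n s = levi (\<gamma> s) (vector_derivative (E ?n) (at s)) (E (2 * ?n) s)"
    using \<gamma>(3) unfolding has_p_curvatures_def by blast
  define e where "e j s = cpx (E j s)" for j s
  define e' where "e' j s = cpx (vector_derivative (E j) (at s))" for j s
  define c where "c k s = cpx (curve_deriv k \<gamma> s)" for k s
  have contact: "contact_deriv k \<gamma> s = lift (\<gamma> s) (c k s)" for k s
    by (simp add: contact_deriv_lift c_def)
  have dc: "(c k has_vector_derivative c (Suc k) s) (at s)" if "s \<in> I" for k s
    unfolding c_def by (rule cpx_curve_deriv[OF I(1) smooth that])
  have oriented: "oriented_frame (\<gamma> s) (\<lambda>j. E j s)" if "s \<in> I" for s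
    using frame that unfolding adapted_frame_def by blast
  note legs = oriented_frame_unitary[OF oriented]
  have unit: "unitary_frame (\<lambda>j. e j s)" if "s \<in> I" for s
    unfolding e_def by (rule legs(1)[OF that])
  have E: "E j s = lift (\<gamma> s) (e j s)" if "s \<in> I" "j \<in> {1..2 * ?n}" for j s
    unfolding e_def by (rule legs(2)[OF that])
  have E_top: "E (2 * ?n) s = lift (\<gamma> s) (\<i> *s e ?n s)" if "s \<in> I" for s
    using E[OF that, of "2 * ?n"] legs(3)[OF that, of ?n] n by (simp add: e_def mult_2)
  have de: "(e j has_vector_derivative e' j s) (at s)" if j: "j \<in> {1..?n}" and s: "s \<in> I" for j s
  proof -
    have "smooth_on I (E j)" using frame j unfolding adapted_frame_def by auto
    then show ?thesis unfolding e_def e'_def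
      by (intro bounded_linear.has_vector_derivative[OF bounded_linear_cpx]
          smooth_on_vector_derivative(1)[OF I(1) _ s])
  qed
  have T: "triangular (\<lambda>k. c k s) (\<lambda>j. e j s)" if s: "s \<in> I" for s
  proof (rule triangular_of_wedge[OF unit[OF s]])
    fix j assume j: "j \<in> {1..?n}"
    have "wedge (\<gamma> s) j (\<lambda>i. E i s) = wedge (\<gamma> s) j (\<lambda>i. lift (\<gamma> s) (e i s))"
      using j by (intro wedge_cong E[OF s]) auto
    moreover have "\<exists>\<epsilon>\<in>{1, -1}. wedge (\<gamma> s) j (\<lambda>i. E i s) =
      (\<lambda>w. \<epsilon> * (wedge (\<gamma> s) j (\<lambda>k. lift (\<gamma> s) (c k s)) w /
        wedge_norm (\<gamma> s) j (\<lambda>k. lift (\<gamma> s) (c k s))))"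
      using frame s j unfolding adapted_frame_def contact by blast
    ultimately show "\<exists>\<epsilon>\<in>{1, -1}. wedge (\<gamma> s) j (\<lambda>i. lift (\<gamma> s) (e i s)) =
      (\<lambda>w. \<epsilon> * (wedge (\<gamma> s) j (\<lambda>k. lift (\<gamma> s) (c k s)) w /
        wedge_norm (\<gamma> s) j (\<lambda>k. lift (\<gamma> s) (c k s))))"
      by (simp only:)
  qed
  have \<kappa>_low: "\<kappa> j s = e' j s \<bullet> e (j + 1) s" if "j \<in> {1..<?n}" "s \<in> I" for j s
    using \<kappa>[OF that(2)] E[OF that(2), of "j + 1"] that(1) by (simp add: levi_lift_right e'_def)
  have \<kappa>_top: "\<kappa> ?n s = e' ?n s \<bullet> (\<i> *s e ?n s)" if "s \<in> I" for s
    using \<kappa>[OF that] E_top[OF that] by (simp add: levi_lift_right e'_def)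
  have frenet: "(e j has_vector_derivative
      (\<Sum>k=1..?n. frenet_matrix ?n (\<lambda>i. \<kappa> i s) j k *s e k s)) (at s)"
    if "j \<in> {1..?n}" "s \<in> I" for j s
    by (rule frenet_of_triangular[OF I(1) de unit dc T \<kappa>_low \<kappa>_top that])
  define t where "t s = c 1 s \<bullet> e 1 s" for s
  have c1: "c 1 s = t s *\<^sub>R e 1 s" if "s \<in> I" for s
    using triangular_combination(1)[OF T[OF that] unit[OF that] n] by (simp add: t_def)
  have t1: "t s \<in> {1, -1}" if s: "s \<in> I" for s
  proof -
    have "c 1 s \<bullet> c 1 s = 1"
      using \<gamma>(2) s by (simp add: horizontal_arc_length_on_def levi_norm_def contact levi_lift_right)
    then have "t s * t s = 1"
      using unitary_frame_inner(1)[OF unit[OF s] n n] by (simp add: c1[OF s])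
    then show ?thesis using square_eq_1_iff[of "t s"] by simp
  qed
  have "continuous_on I t"
    unfolding t_def using has_vector_derivative_continuous[OF dc] has_vector_derivative_continuous[OF de[OF n]]
    by (intro continuous_on_inner continuous_at_imp_continuous_on) auto
  moreover have "finite (t ` I)" by (rule finite_subset[of _ "{1, -1}"]) (use t1 in auto)
  ultimately have "t constant_on I"
    using continuous_finite_range_constant[OF is_interval_connected[OF I(2)]] by blast
  then obtain \<tau>' where \<tau>': "\<And>s. s \<in> I \<Longrightarrow> t s = \<tau>'" unfolding constant_on_def by blast
  \<comment> \<open>On the empty interval the constant value of \<open>t\<close> is arbitrary.\<close>
  define \<tau> where "\<tau> = (if I = {} then 1 else \<tau>')"
  have \<tau>: "t s = \<tau>" if "s \<in> I" for s using \<tau>'[OF that] that by (auto simp: \<tau>_def)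
  have abs: "\<bar>\<tau>\<bar> = 1"
  proof (cases "I = {}")
    case False
    then show ?thesis using t1 \<tau> by fastforce
  qed (simp add: \<tau>_def)
  have tangent: "(\<gamma> has_vector_derivative lift (\<gamma> s) (\<tau> *\<^sub>R e 1 s)) (at s)" if s: "s \<in> I" for s
  proof -
    have "curve_deriv 1 \<gamma> s = lift (\<gamma> s) (c 1 s)"
      using \<gamma>(1) s unfolding horizontal_on_def contact by simp
    then have "curve_deriv (Suc 0) \<gamma> s = lift (\<gamma> s) (\<tau> *\<^sub>R e 1 s)"
      using c1[OF s] \<tau>[OF s] by (simp add: One_nat_def)
    then show ?thesis
      using curve_deriv_has_vector_derivative[OF I(1) smooth s, of 0] by (simp add: curve_deriv_def)
  qed
  show thesis by (rule that[OF frenet unit abs tangent])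
qed

text \<open>
  Integration: the complex coordinates of \<open>\<gamma>\<^sub>2\<close> and the image under \<open>W\<close> of those of \<open>\<gamma>\<^sub>1\<close> have the
  same derivative and differ by a constant \<open>a\<close>. Then
  \<open>Im \<langle>W x\<^sub>1 + a, W v\<rangle> = Im \<langle>x\<^sub>1, v\<rangle> + Im \<langle>a, W v\<rangle>\<close> compares the derivatives of the heights.
\<close>

lemma rigid_motion_of_equal_tangents:
  fixes \<gamma>\<^sub>1 \<gamma>\<^sub>2 :: "real \<Rightarrow> 'n::finite heis"
  assumes I: "is_interval I"
    and d1: "\<And>s. s \<in> I \<Longrightarrow> (\<gamma>\<^sub>1 has_vector_derivative lift (\<gamma>\<^sub>1 s) (v s)) (at s)"
    and d2: "\<And>s. s \<in> I \<Longrightarrow> (\<gamma>\<^sub>2 has_vector_derivative lift (\<gamma>\<^sub>2 s) (W (v s))) (at s)"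
    and W: "linear W" "\<And>u v. hprod (W u) (W v) = hprod u v"
  shows "\<exists>a b. \<forall>s\<in>I. \<gamma>\<^sub>2 s = rigid_motion W a b (\<gamma>\<^sub>1 s)"
proof -
  have bW: "bounded_linear W" using W(1) by (simp add: linear_conv_bounded_linear)
  have dx1: "((\<lambda>s. cpx (\<gamma>\<^sub>1 s)) has_vector_derivative v s) (at s)" if "s \<in> I" for s
    using bounded_linear.has_vector_derivative[OF bounded_linear_cpx d1[OF that]] by simp
  have dx2: "((\<lambda>s. cpx (\<gamma>\<^sub>2 s)) has_vector_derivative W (v s)) (at s)" if "s \<in> I" for s
    using bounded_linear.has_vector_derivative[OF bounded_linear_cpx d2[OF that]] by simp
  have dWx1: "((\<lambda>s. W (cpx (\<gamma>\<^sub>1 s))) has_vector_derivative W (v s)) (at s)" if "s \<in> I" for s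
    by (rule bounded_linear.has_vector_derivative[OF bW dx1[OF that]])
  have "((\<lambda>s. cpx (\<gamma>\<^sub>2 s) - W (cpx (\<gamma>\<^sub>1 s))) has_vector_derivative 0) (at s within I)" if "s \<in> I" for s
    using has_vector_derivative_diff[OF dx2[OF that] dWx1[OF that]]
    by (simp add: has_vector_derivative_at_within)
  from has_vector_derivative_zero_constant[OF is_interval_convex[OF I] this]
  obtain a where a: "\<And>s. s \<in> I \<Longrightarrow> cpx (\<gamma>\<^sub>2 s) - W (cpx (\<gamma>\<^sub>1 s)) = a" by metis
  have x2: "cpx (\<gamma>\<^sub>2 s) = W (cpx (\<gamma>\<^sub>1 s)) + a" if "s \<in> I" for s
    using a[OF that] by (simp add: algebra_simps)
  let ?z = "\<lambda>s. height (\<gamma>\<^sub>2 s) - height (\<gamma>\<^sub>1 s) - Im (hprod a (W (cpx (\<gamma>\<^sub>1 s))))"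
  have "(?z has_vector_derivative 0) (at s within I)" if s: "s \<in> I" for s
  proof -
    have "bounded_linear (\<lambda>u. Im (hprod a u))"
      by (rule bounded_linear_compose[OF bounded_linear_Im
            bounded_bilinear.bounded_linear_right[OF bounded_bilinear_hprod]])
    then have "((\<lambda>s. Im (hprod a (W (cpx (\<gamma>\<^sub>1 s))))) has_vector_derivative Im (hprod a (W (v s)))) (at s)"
      by (rule bounded_linear.has_vector_derivative[OF _ dWx1[OF s]])
    moreover have "((\<lambda>s. height (\<gamma>\<^sub>1 s)) has_vector_derivative Im (hprod (cpx (\<gamma>\<^sub>1 s)) (v s))) (at s)"
      using bounded_linear.has_vector_derivative[OF bounded_linear_height d1[OF s]]
      by (simp add: height_lift)
    moreover have "((\<lambda>s. height (\<gamma>\<^sub>2 s)) has_vector_derivative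
        Im (hprod (W (cpx (\<gamma>\<^sub>1 s)) + a) (W (v s)))) (at s)"
      using bounded_linear.has_vector_derivative[OF bounded_linear_height d2[OF s]]
      by (simp add: height_lift x2[OF s])
    ultimately have "(?z has_vector_derivative Im (hprod (W (cpx (\<gamma>\<^sub>1 s)) + a) (W (v s))) -
        Im (hprod (cpx (\<gamma>\<^sub>1 s)) (v s)) - Im (hprod a (W (v s)))) (at s)"
      by (intro has_vector_derivative_diff)
    then show ?thesis by (simp add: hprod_linear W(2) has_vector_derivative_at_within)
  qed
  from has_vector_derivative_zero_constant[OF is_interval_convex[OF I] this]
  obtain b where b: "\<And>s. s \<in> I \<Longrightarrow> ?z s = b" by metis
  have "\<gamma>\<^sub>2 s = rigid_motion W a b (\<gamma>\<^sub>1 s)" if "s \<in> I" for s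
    using x2[OF that] b[OF that] by (intro heis_eqI) (simp_all add: rigid_motion_def algebra_simps)
  then show ?thesis by blast
qed

text \<open>
  The Frenet frames of both curves solve the same linear system, so the unitary map from one to the
  other does not depend on the parameter; up to sign it carries tangent to tangent.
\<close>

lemma equal_p_curvatures_rigid_motion:
  fixes \<gamma>\<^sub>1 \<gamma>\<^sub>2 :: "real \<Rightarrow> 'n::finite heis"
  assumes I: "open I" "is_interval I" "s\<^sub>0 \<in> I"
    and \<gamma>\<^sub>1: "horizontal_on I \<gamma>\<^sub>1" "horizontal_arc_length_on I \<gamma>\<^sub>1" "has_p_curvatures I \<gamma>\<^sub>1 \<kappa>"
    and \<gamma>\<^sub>2: "horizontal_on I \<gamma>\<^sub>2" "horizontal_arc_length_on I \<gamma>\<^sub>2" "has_p_curvatures I \<gamma>\<^sub>2 \<kappa>"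
  shows "\<exists>\<Phi>\<in>PSH. \<forall>s\<in>I. \<gamma>\<^sub>2 s = \<Phi> (\<gamma>\<^sub>1 s)"
proof -
  let ?n = "CARD('n)"
  have n: "1 \<in> {1..?n}" by (simp add: Suc_le_eq One_nat_def)
  obtain e \<sigma> where e: "\<And>j s. j \<in> {1..?n} \<Longrightarrow> s \<in> I \<Longrightarrow> (e j has_vector_derivative
      (\<Sum>k=1..?n. frenet_matrix ?n (\<lambda>i. \<kappa> i s) j k *s e k s)) (at s)"
    "\<And>s. s \<in> I \<Longrightarrow> unitary_frame (\<lambda>j. e j s)" "\<bar>\<sigma>\<bar> = 1"
    "\<And>s. s \<in> I \<Longrightarrow> (\<gamma>\<^sub>1 has_vector_derivative lift (\<gamma>\<^sub>1 s) (\<sigma> *\<^sub>R e 1 s)) (at s)"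
    by (rule frenet_frame_of_curve[OF I(1,2) \<gamma>\<^sub>1]) blast
  obtain f \<tau> where f: "\<And>j s. j \<in> {1..?n} \<Longrightarrow> s \<in> I \<Longrightarrow> (f j has_vector_derivative
      (\<Sum>k=1..?n. frenet_matrix ?n (\<lambda>i. \<kappa> i s) j k *s f k s)) (at s)"
    "\<And>s. s \<in> I \<Longrightarrow> unitary_frame (\<lambda>j. f j s)" "\<bar>\<tau>\<bar> = 1"
    "\<And>s. s \<in> I \<Longrightarrow> (\<gamma>\<^sub>2 has_vector_derivative lift (\<gamma>\<^sub>2 s) (\<tau> *\<^sub>R f 1 s)) (at s)"
    by (rule frenet_frame_of_curve[OF I(1,2) \<gamma>\<^sub>2]) blast
  obtain K where K: "\<forall>s\<in>I. \<forall>a b. (\<Sum>j=1..?n. cnj (e j s $ a) * f j s $ b) = K a b"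
    using moving_frames_product_constant[OF I(2) e(1) f(1) frenet_matrix_antihermitian] ..
  define U where "U s = frame_change (\<lambda>j. e j s) (\<lambda>j. f j s)" for s
  have U: "U s v $ b = (\<Sum>a\<in>UNIV. v $ a * K a b)" if "s \<in> I" for s v b
  proof -
    have "U s v $ b = (\<Sum>j=1..?n. \<Sum>a\<in>UNIV. v $ a * (cnj (e j s $ a) * f j s $ b))"
      by (simp add: U_def frame_change_def hprod_def sum_distrib_right mult.assoc)
    also have "\<dots> = (\<Sum>a\<in>UNIV. \<Sum>j=1..?n. v $ a * (cnj (e j s $ a) * f j s $ b))"
      by (rule sum.swap)
    finally show ?thesis using K that by (simp flip: sum_distrib_left)
  qed
  have U_const: "U s = U s\<^sub>0" if "s \<in> I" for s
    by (rule ext) (simp add: vec_eq_iff U[OF that] U[OF I(3)])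
  \<comment> \<open>Tangents are \<open>\<sigma> e\<^sub>1\<close> and \<open>\<tau> f\<^sub>1\<close>, so the map between the frames is corrected by a sign.\<close>
  define W where "W v = (\<sigma> * \<tau>) *\<^sub>R U s\<^sub>0 v" for v
  define W' where "W' v = (\<sigma> * \<tau>) *\<^sub>R frame_change (\<lambda>j. f j s\<^sub>0) (\<lambda>j. e j s\<^sub>0) v" for v
  have sq: "\<sigma> * \<sigma> = 1" "\<tau> * \<tau> = 1" using e(3) f(3) by (auto simp: abs_if split: if_splits)
  then have sq': "\<sigma> * (\<tau> * (\<sigma> * \<tau>)) = 1" by (metis mult.assoc mult.commute mult_1)
  have lin: "linear W" "linear W'"
    unfolding W_def[abs_def] W'_def[abs_def] U_def
    by (intro linear_compose_scale_right linear_frame_change)+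
  have iso: "hprod (W u) (W v) = hprod u v" for u v
    using sq' by (simp add: W_def U_def hprod_linear frame_change_isometry[OF e(2) f(2)] I(3) mult.assoc)
  have inv: "W (W' v) = v" "W' (W v) = v" for v
    using sq' by (simp_all add: W_def W'_def U_def linear_scale[OF linear_frame_change]
        frame_change_inverse e(2) f(2) I(3) mult.assoc)
  have J: "W (\<i> *s v) = \<i> *s W v" for v
    by (simp add: W_def U_def frame_change_scale vec_eq_iff)
  have tangent: "\<tau> *\<^sub>R f 1 s = W (\<sigma> *\<^sub>R e 1 s)" if "s \<in> I" for s
  proof -
    have "U s (e 1 s) = f 1 s"
      unfolding U_def by (rule frame_change_leg[OF e(2)[OF that] n])
    then have "U s\<^sub>0 (e 1 s) = f 1 s" by (simp only: U_const[OF that])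
    then show ?thesis
      using sq by (simp add: W_def U_def linear_scale[OF linear_frame_change] mult_ac)
  qed
  have d2: "(\<gamma>\<^sub>2 has_vector_derivative lift (\<gamma>\<^sub>2 s) (W (\<sigma> *\<^sub>R e 1 s))) (at s)" if "s \<in> I" for s
    using f(4)[OF that] tangent[OF that] by simp
  have "\<exists>a b. \<forall>s\<in>I. \<gamma>\<^sub>2 s = rigid_motion W a b (\<gamma>\<^sub>1 s)"
    by (rule rigid_motion_of_equal_tangents[OF I(2) e(4) d2 lin(1) iso])
  then obtain a b where "\<forall>s\<in>I. \<gamma>\<^sub>2 s = rigid_motion W a b (\<gamma>\<^sub>1 s)" by blast
  moreover have "rigid_motion W a b \<in> PSH"
    by (rule rigid_motion_in_PSH[OF lin(1) J iso lin(2) inv])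
  ultimately show ?thesis by blast
qed

theorem corollary1p3:
  fixes I :: "real set"
  assumes "open I" and "is_interval I"
  shows
    "(\<forall>\<kappa> :: nat \<Rightarrow> real \<Rightarrow> real.
        (\<forall>j\<in>{1..CARD('n)}. smooth_on I (\<kappa> j)) \<longrightarrow>
        (\<forall>j\<in>{1..<CARD('n)}. \<forall>s\<in>I. \<kappa> j s \<noteq> 0) \<longrightarrow>
        (\<exists>\<gamma> :: real \<Rightarrow> 'n::finite heis.
           horizontal_on I \<gamma> \<and> horizontal_arc_length_on I \<gamma> \<and> has_p_curvatures I \<gamma> \<kappa>)) \<and>
     (\<forall>(\<gamma>\<^sub>1 :: real \<Rightarrow> 'n heis) (\<gamma>\<^sub>2 :: real \<Rightarrow> 'n heis) \<kappa>.
        horizontal_on I \<gamma>\<^sub>1 \<longrightarrow> horizontal_arc_length_on I \<gamma>\<^sub>1 \<longrightarrow> has_p_curvatures I \<gamma>\<^sub>1 \<kappa> \<longrightarrow>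
        horizontal_on I \<gamma>\<^sub>2 \<longrightarrow> horizontal_arc_length_on I \<gamma>\<^sub>2 \<longrightarrow> has_p_curvatures I \<gamma>\<^sub>2 \<kappa> \<longrightarrow>
        (\<exists>\<Phi>\<in>PSH. \<forall>s\<in>I. \<gamma>\<^sub>2 s = \<Phi> (\<gamma>\<^sub>1 s)))"
proof (cases "I = {}")
  case True
  have "horizontal_on {} (\<lambda>_. 0 :: 'n heis)" "horizontal_arc_length_on {} (\<lambda>_. 0 :: 'n heis)"
    "has_p_curvatures {} (\<lambda>_. 0 :: 'n heis) \<kappa>" for \<kappa>
    unfolding horizontal_on_def horizontal_arc_length_on_def has_p_curvatures_def
      nondegenerate_on_def horizontally_regular_on_def adapted_frame_def
    by (auto simp: smooth_on_const intro!: exI[of _ "\<lambda>_ _. 0"])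
  moreover have "rigid_motion id 0 0 \<in> (PSH :: ('n heis \<Rightarrow> 'n heis) set)"
    by (rule rigid_motion_in_PSH[where W' = id]) (simp_all add: linear_id)
  ultimately show ?thesis unfolding True by blast
next
  case False
  then obtain s\<^sub>0 where s\<^sub>0: "s\<^sub>0 \<in> I" by blast
  show ?thesis
  proof (intro conjI allI impI)
    show "\<exists>\<gamma> :: real \<Rightarrow> 'n heis.
        horizontal_on I \<gamma> \<and> horizontal_arc_length_on I \<gamma> \<and> has_p_curvatures I \<gamma> \<kappa>"
      if "\<forall>j\<in>{1..CARD('n)}. smooth_on I (\<kappa> j)" "\<forall>j\<in>{1..<CARD('n)}. \<forall>s\<in>I. \<kappa> j s \<noteq> 0" for \<kappa>
      by (rule curve_with_p_curvatures_exists[OF assms s\<^sub>0]) (use that in blast)+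
  qed (rule equal_p_curvatures_rigid_motion[OF assms s\<^sub>0])
qed

end
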